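(* For every integer $n\ge 3$, the threshold bias of the $(1:q)$ Budget Threat-Avoiding Triangle Game on $K_n$ satisfies $$q_\triangle^t(n)\in\left[\left\lceil\sqrt{2n-2}-\frac{3}{2}\right\rceil,\ \left\lceil\sqrt{2n}\right\rceil+1\right].$$ In particular, $q_\triangle^t(n)=\big(\sqrt 2+o(1)\big)\sqrt n$ as $n\to\infty$.
   Context: For an integer $n\ge 3$ and a non-negative integer $q$, the $(1:q)$ Budget Threat-Avoiding Triangle Game on the complete graph $K_n$ is played by Maker and Breaker, who take alternate turns, with Maker beginning. An edge $\{u,v\}$ is called a threat if it is unclaimed and there is a vertex $w$ such that Maker has claimed both $\{u,w\}$ and $\{w,v\}$ (so Maker would complete a triangle by claiming it). In her turn, Maker claims one previously unclaimed edge of $K_n$. In his turn, Breaker may claim an arbitrary number (possibly zero) of previously unclaimed edges of $K_n$, at most $q$ of which are threat edges, subject to the condition that at the end of his turn the total number of edges claimed by Breaker so far is at most $q$ times the total number of edges claimed by Maker so far. Maker wins if she manages to claim all three edges of a triangle; otherwise, Breaker wins. The threshold bias $q_\triangle^t(n)$ is the smallest non-negative integer $q$ such that Breaker has a winning strategy in this game. *)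

theory Defs
  imports Complex_Main "HOL-Library.Landau_Symbols"
begin

type_synonym edge = "nat set"

text \<open>A round is Maker's edge together with the set of edges Breaker claims in reply; a history
  is the list of all rounds completed so far, earliest first.\<close>

type_synonym history = "(edge \<times> edge set) list"

definition edges :: "nat \<Rightarrow> edge set" where
  "edges n = {e. e \<subseteq> {..<n} \<and> card e = 2}"

definition maker_edges :: "history \<Rightarrow> edge set" where
  "maker_edges h = fst ` set h"

definition breaker_edges :: "history \<Rightarrow> edge set" where
  "breaker_edges h = \<Union> (snd ` set h)"

definition unclaimed :: "nat \<Rightarrow> edge set \<Rightarrow> edge set \<Rightarrow> edge set" where
  "unclaimed n M B = edges n - (M \<union> B)"

definition threats :: "nat \<Rightarrow> edge set \<Rightarrow> edge set \<Rightarrow> edge set" where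
  "threats n M B =
     {{u, v} | u v. {u, v} \<in> unclaimed n M B \<and> (\<exists>w. {u, w} \<in> M \<and> {w, v} \<in> M)}"

definition has_triangle :: "edge set \<Rightarrow> bool" where
  "has_triangle M \<longleftrightarrow>
     (\<exists>u v w. u \<noteq> v \<and> v \<noteq> w \<and> u \<noteq> w \<and> {u, v} \<in> M \<and> {v, w} \<in> M \<and> {u, w} \<in> M)"

text \<open>Here \<open>M\<close> and \<open>B\<close> are the edges held by Maker and Breaker at the start of
  Breaker's turn, so \<open>M\<close> includes the edge Maker has just claimed. Since \<open>M\<close> does not change
  during Breaker's turn, the threats he may claim are those of the position \<open>(M, B)\<close>.\<close>

definition legal_reply :: "nat \<Rightarrow> nat \<Rightarrow> edge set \<Rightarrow> edge set \<Rightarrow> edge set \<Rightarrow> bool" where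
  "legal_reply n q M B S \<longleftrightarrow>
     S \<subseteq> unclaimed n M B \<and>
     card (S \<inter> threats n M B) \<le> q \<and>
     card (B \<union> S) \<le> q * card M"

text \<open>A strategy of Breaker maps the completed rounds and Maker's current edge to a reply.\<close>

type_synonym strategy = "history \<Rightarrow> edge \<Rightarrow> edge set"

inductive is_play :: "nat \<Rightarrow> strategy \<Rightarrow> history \<Rightarrow> bool" for n \<sigma> where
  start: "is_play n \<sigma> []"
| round: "is_play n \<sigma> h \<Longrightarrow> e \<in> unclaimed n (maker_edges h) (breaker_edges h) \<Longrightarrow>
          is_play n \<sigma> (h @ [(e, \<sigma> h e)])"

text \<open>Plays are formally continued, until the board is full, even if Maker owns a triangle. This
  is harmless: legality of the replies can always be kept by claiming nothing, and no such play
  is consistent with a winning strategy of Breaker.\<close>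

definition legal_strategy :: "nat \<Rightarrow> nat \<Rightarrow> strategy \<Rightarrow> bool" where
  "legal_strategy n q \<sigma> \<longleftrightarrow>
     (\<forall>h e. is_play n \<sigma> h \<longrightarrow> e \<in> unclaimed n (maker_edges h) (breaker_edges h) \<longrightarrow>
        legal_reply n q (insert e (maker_edges h)) (breaker_edges h) (\<sigma> h e))"

definition winning_strategy :: "nat \<Rightarrow> nat \<Rightarrow> strategy \<Rightarrow> bool" where
  "winning_strategy n q \<sigma> \<longleftrightarrow>
     legal_strategy n q \<sigma> \<and> (\<forall>h. is_play n \<sigma> h \<longrightarrow> \<not> has_triangle (maker_edges h))"

definition breaker_wins :: "nat \<Rightarrow> nat \<Rightarrow> bool" where
  "breaker_wins n q \<longleftrightarrow> (\<exists>\<sigma>. winning_strategy n q \<sigma>)"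

definition threshold_bias :: "nat \<Rightarrow> nat" where
  "threshold_bias n = (LEAST q. breaker_wins n q)"

text \<open>The minimum defining the threshold bias exists: with a large enough bias, Breaker claims
  the whole remaining board in his first turn.\<close>

lemma breaker_wins_exists: "\<exists>q. breaker_wins n q"
proof -
  let ?\<sigma> = "\<lambda>(h::history) e. unclaimed n (insert e (maker_edges h)) (breaker_edges h)"
  have fin: "finite (edges n)"
    by (rule finite_subset[of _ "Pow {..<n}"]) (auto simp: edges_def)
  have plays: "h = [] \<or> (\<exists>e. e \<in> edges n \<and> h = [(e, edges n - {e})])" if "is_play n ?\<sigma> h" for h
    using that
    by induction (auto simp: unclaimed_def maker_edges_def breaker_edges_def)
  have reply: "legal_reply n (card (edges n)) (insert e (maker_edges h)) (breaker_edges h) (?\<sigma> h e)"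
    if "is_play n ?\<sigma> h" and e: "e \<in> unclaimed n (maker_edges h) (breaker_edges h)" for h e
  proof -
    have "h = []"
      using plays[OF that(1)] e by (auto simp: unclaimed_def maker_edges_def breaker_edges_def)
    then show ?thesis
      by (auto simp: legal_reply_def unclaimed_def maker_edges_def breaker_edges_def
          intro!: card_mono fin)
  qed
  have "\<not> has_triangle (maker_edges h)" if "is_play n ?\<sigma> h" for h
    using plays[OF that] by (auto simp: has_triangle_def maker_edges_def doubleton_eq_iff)
  with reply have "winning_strategy n (card (edges n)) ?\<sigma>"
    unfolding winning_strategy_def legal_strategy_def by blast
  then show ?thesis
    unfolding breaker_wins_def by blast
qed

end

theory Submission
  imports Defs
begin

text \<open>
  Lower bound: Maker builds a star. As long as she has no triangle, all pairs of leaves belong to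
  Breaker, so of his at most \<open>q d\<close> edges only \<open>q d - d (d - 1) / 2\<close> can block the centre; hence the
  star grows to \<open>2 q + 2\<close> leaves, and then the pairs of leaves alone exceed the budget.

  Upper bound: call a vertex heavy if its Maker degree exceeds \<open>q / 2\<close>, and light otherwise. An edge
  \<open>xz\<close> is young at \<open>z\<close> if it is among the first \<open>\<lfloor>q / 2\<rfloor>\<close> Maker edges at \<open>z\<close>. Breaker always owns
  exactly the following pairs not claimed by Maker: those with a common Maker neighbour, those with
  both ends heavy, and the pairs of a heavy \<open>h\<close> and a light \<open>x\<close> for which the degree of \<open>h\<close> plus the
  number of Maker edges \<open>xz\<close> young at \<open>z\<close> is at least \<open>q - 2\<close>. If Maker claims any other such
  pair \<open>hx\<close>, the threats she creates join \<open>x\<close> to a neighbour of \<open>h\<close>, or \<open>h\<close> to a light neighbour \<open>z\<close> of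
  \<open>x\<close>, and then \<open>xz\<close> is young at \<open>z\<close>; so there are fewer than \<open>q - 2\<close> of them. Two light ends create at
  most \<open>q\<close> threats.

  The budget is verified by a discharging argument in the Maker graph. Since
  \<open>n \<le> q (q - 2) / 2 + 1 / 2\<close>, it suffices that every vertex \<open>v\<close> of degree \<open>d v\<close> has income
  \<open>(q / 2) (q - 2) (d v)\<close> and every pair of Breaker costs \<open>q - 2\<close>. Two heavy or two light ends
  share the cost equally; otherwise the heavy end \<open>h\<close> pays \<open>d h\<close> and the light end the rest.
  Heavy vertices then have a surplus. A light vertex can always pay for its pairs with a common
  neighbour, and it pays for the remaining ones from what its young edges leave over; if a young edge
  leads to a vertex that has become heavy, the surplus of that vertex is used.
\<close>

subsection \<open>The discharging argument\<close>


text \<open>Once \<open>c\<close> is replaced by \<open>a + 1\<close>, the claim is linear in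
  \<open>m\<close> and tightest at \<open>m = a * (a + 2)\<close>. It lets a heavy vertex of degree
  \<open>d\<close> cover the deficits of its young edges when \<open>m + 1\<close> vertices are
  heavy.\<close>

lemma young_excess_le:
  fixes c m :: real
  assumes "c \<le> a + 1" "1 \<le> a" "a \<le> d" "d \<le> 2 * a" "0 \<le> m" "m \<le> a * (a + 2)" "0 \<le> c"
  shows "c * max 0 (m - a * (2 * a + 3 - d)) \<le> m * (d - a)"
proof (cases "m - a * (2 * a + 3 - d) \<le> 0")
  case True
  then show ?thesis using assms by simp
next
  case False
  define s where "s = d - a"
  have s: "0 \<le> s" "s \<le> a" using assms by (auto simp: s_def)
  have "c * max 0 (m - a * (2 * a + 3 - d)) \<le> (a + 1) * (m - a * (a + 3 - s))"
  proof -
    have e: "2 * a + 3 - d = a + 3 - s" by (simp add: s_def)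
    then have "max 0 (m - a * (2 * a + 3 - d)) = m - a * (a + 3 - s)"
      using False by simp
    moreover have "0 \<le> m - a * (a + 3 - s)" using False e by simp
    ultimately show ?thesis using assms by (simp add: mult_right_mono)
  qed
  also have "\<dots> \<le> m * s"
  proof -
    have "m * (a + 1 - s) \<le> (a * (a + 2)) * (a + 1 - s)"
      using assms s by (intro mult_right_mono) auto
    also have "\<dots> \<le> (a + 1) * (a * (a + 3 - s))"
    proof -
      \<comment> \<open>The slack at the extreme value of \<open>m\<close>.\<close>
      have "(a + 1) * (a * (a + 3 - s)) - (a * (a + 2)) * (a + 1 - s) = a * (a + 1 + s)"
        by algebra
      moreover have "0 \<le> a * (a + 1 + s)" using assms s by simp
      ultimately show ?thesis by linarith
    qed
    finally show ?thesis by (simp add: algebra_simps)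
  qed
  finally show ?thesis by (simp add: s_def)
qed


text \<open>Beyond the corner, \<open>a * (t + u) \<le> 2 * a^2 \<le> 2 * k\<close> bounds the slope
  of the square. The corner \<open>u\<close> will depend on a light vertex; the quadratic in
  \<open>t\<close> does not, so it can be summed over all light vertices.\<close>

lemma hinge_ge_square:
  fixes a k t u :: real
  assumes "0 \<le> a" "a\<^sup>2 \<le> k" "0 < k" "0 \<le> t" "t \<le> a" "0 \<le> u" "u \<le> a"
  shows "a * t\<^sup>2 / k \<le> 2 * max 0 (t - u) + a * u\<^sup>2 / k"
proof (cases "t \<le> u")
  case True
  then have "a * t\<^sup>2 \<le> a * u\<^sup>2" using assms by (intro mult_left_mono power_mono) auto
  then show ?thesis using assms True by (simp add: divide_right_mono)
next
  case False
  have "a * (t + u) \<le> a * (2 * a)" using assms by (intro mult_left_mono) auto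
  also have "\<dots> \<le> 2 * k" using assms by (simp add: power2_eq_square)
  finally have "a * (t + u) * (t - u) \<le> 2 * k * (t - u)"
    using False by (intro mult_right_mono) auto
  then have "a * t\<^sup>2 - a * u\<^sup>2 \<le> (2 * (t - u)) * k"
    by (simp add: power2_eq_square algebra_simps)
  then have "(a * t\<^sup>2 - a * u\<^sup>2) / k \<le> 2 * (t - u)"
    using assms by (simp add: divide_le_eq)
  then show ?thesis using False by (simp add: diff_divide_distrib)
qed


text \<open>After inserting the lower bounds for \<open>k\<close> and \<open>b\<close>, what remains
  is a quadratic in \<open>s = t - a / 2\<close>, and
  \<open>s * s \<le> s * (a / 4) + a^2 / 8\<close> for \<open>0 \<le> s \<le> a / 2\<close>.\<close>

lemma small_degree_ge_square:
  fixes a k t b :: real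
  assumes "1 \<le> a" "a * (a + 2) \<le> k" "t \<le> a" "a / 2 \<le> t" "a - t \<le> b"
  shows "a * t\<^sup>2 / k \<le> 2 * t - a + b * (3/4 * a\<^sup>2 + 2 * a) / k"
proof -
  have k: "0 < k" proof -
    have "0 < a * (a + 2)" using assms by simp
    then show ?thesis using assms by linarith
  qed
  have "(a * (a + 2)) * (2 * t - a) \<le> k * (2 * t - a)"
    using assms by (intro mult_right_mono) auto
  moreover have "(a - t) * (3/4 * a\<^sup>2 + 2 * a) \<le> b * (3/4 * a\<^sup>2 + 2 * a)"
    using assms by (intro mult_right_mono) auto
  moreover have "a * t\<^sup>2 \<le> (a * (a + 2)) * (2 * t - a) + (a - t) * (3/4 * a\<^sup>2 + 2 * a)"
  proof -
    define s where "s = t - a / 2"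
    have s: "0 \<le> s" "s \<le> a / 2" using assms by (auto simp: s_def)
    have eq: "(a * (a + 2)) * (2 * t - a) + (a - t) * (3/4 * a\<^sup>2 + 2 * a) - a * t\<^sup>2
      = a * (s * (a / 4 + 2) + a\<^sup>2 / 8 + a - s * s)"
    proof -
      define b where "b = a / 8"
      have "a = 8 * b" "t = s + 4 * b" by (simp_all add: s_def b_def)
      then show ?thesis by (simp add: power2_eq_square algebra_simps)
    qed
    have "s * s \<le> s * (a / 2)" using s by (intro mult_left_mono) auto
    moreover have "s * (a / 4) \<le> (a / 2) * (a / 4)" using s assms by (intro mult_right_mono) auto
    moreover have "s * (a / 2) = 2 * (s * (a / 4))" "a\<^sup>2 / 8 = (a / 2) * (a / 4)"
      "s * (a / 4 + 2) = s * (a / 4) + 2 * s"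
      by (simp_all add: power2_eq_square algebra_simps)
    ultimately have "0 \<le> s * (a / 4 + 2) + a\<^sup>2 / 8 + a - s * s"
      using s assms by linarith
    then have "0 \<le> a * (s * (a / 4 + 2) + a\<^sup>2 / 8 + a - s * s)" using assms by simp
    with eq show ?thesis by linarith
  qed
  ultimately have "a * t\<^sup>2 \<le> (2 * t - a) * k + b * (3/4 * a\<^sup>2 + 2 * a)"
    by (simp add: mult.commute)
  then have "a * t\<^sup>2 / k \<le> ((2 * t - a) * k + b * (3/4 * a\<^sup>2 + 2 * a)) / k"
    using k by (intro divide_right_mono) auto
  then show ?thesis using k by (simp add: add_divide_distrib)
qed


text \<open>The final account of a heavy vertex: its surplus, less \<open>t\<close> for each of
  \<open>l\<close> light vertices, plus what these leave over, less the support of its young edges.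
  Since \<open>c * (t - 1)^2 \<le> a * t^2\<close> and \<open>t \<le> a\<close>, it reduces to
  \<open>a^2 * (k - l) \<le> k * (k - 1 - l)\<close>.\<close>

lemma many_heavy_balance:
  fixes a k l t c :: real
  assumes a: "3/2 \<le> a" and k: "a * (a + 2) \<le> k" and kl: "k + l \<le> 2 * a * (a + 1) + 1/2"
    and l: "0 \<le> l" and t: "3/2 \<le> t" "t \<le> a" and c: "c \<le> a + 1"
  shows "0 \<le> (k - 1 - l) * t + l * (a * t\<^sup>2 / k) - c * (t - 1)\<^sup>2"
proof -
  have a2: "2 * a * (a + 1) = 2 * a\<^sup>2 + 2 * a" "a * (a + 2) = a\<^sup>2 + 2 * a"
    by (auto simp: power2_eq_square algebra_simps)
  have k0: "0 < k" proof -
    have "0 < a * (a + 2)" using a by simp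
    then show ?thesis using k by linarith
  qed
  have "c * (t - 1)\<^sup>2 \<le> (a + 1) * (t - 1)\<^sup>2" using c by (intro mult_right_mono) auto
  also have "\<dots> \<le> a * t\<^sup>2"
  proof -
    have "t * t \<le> a * t" using t by (intro mult_right_mono) auto
    moreover have "a * 1 \<le> a * t" using t a by (intro mult_left_mono) auto
    ultimately have "t * t + a + 1 \<le> 2 * (a * t) + 2 * t" using t by linarith
    then show ?thesis by (simp add: power2_eq_square algebra_simps)
  qed
  finally have 1: "c * (t - 1)\<^sup>2 \<le> a * t\<^sup>2" .
  \<comment> \<open>The excess of \<open>k\<close> over \<open>a * (a + 2)\<close>; the bound on
    \<open>k + l\<close> then makes \<open>k - l\<close> grow like \<open>2 * j\<close>.\<close>
  define j where "j = k - a\<^sup>2 - 2 * a"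
  have j: "0 \<le> j" using k a2 by (simp add: j_def)
  have kl': "2 * a + 2 * j - 1/2 \<le> k - l" 
  proof -
    have "k + l \<le> 2 * a\<^sup>2 + 2 * a + 1/2" using kl a2(1) by linarith
    then show ?thesis unfolding j_def by (simp add: field_simps)
  qed
  have "k \<le> (2 * a + j) * (2 * a + 2 * j - 1/2)"
  proof -
    have "(2 * a + j) * (2 * a + 2 * j - 1/2) - k = 3 * a\<^sup>2 - 3 * a + 6 * (a * j) + 2 * (j * j) - 3/2 * j"
    proof -
      have "k = j + a\<^sup>2 + 2 * a" by (simp add: j_def)
      then show ?thesis by (simp add: power2_eq_square algebra_simps)
    qed
    moreover have "j \<le> a * j" using a j mult_right_mono[of 1 a j] by simp
    moreover have "0 \<le> j * j" by simp
    moreover have "a \<le> a\<^sup>2" using a by (simp add: power2_eq_square)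
    ultimately show ?thesis using j by linarith
  qed
  also have "\<dots> \<le> (2 * a + j) * (k - l)" using kl' a j by (intro mult_left_mono) auto
  also have "\<dots> = (k - a\<^sup>2) * (k - l)"
  proof -
    have "2 * a + j = k - a\<^sup>2" by (simp add: j_def)
    then show ?thesis by simp
  qed
  finally have 2: "a\<^sup>2 * (k - l) \<le> k * (k - 1 - l)" by (simp add: algebra_simps)
  have "0 \<le> k - l" using kl' a j by linarith
  then have "a * t * (k - l) \<le> a\<^sup>2 * (k - l)"
    using t a by (intro mult_right_mono) (auto simp: power2_eq_square)
  with 2 have "a * t * (k - l) * t \<le> k * (k - 1 - l) * t"
    using t by (intro mult_right_mono) auto
  then have "a * t\<^sup>2 - l * (a * t\<^sup>2 / k) \<le> (k - 1 - l) * t"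
    using k0 by (simp add: field_simps power2_eq_square)
  with 1 show ?thesis by linarith
qed

text \<open>\<open>N\<close> is Maker's graph, \<open>x \<in> Y z\<close> means that the edge \<open>xz\<close> is young at \<open>z\<close>, and \<open>C\<close> holds
  Breaker's edges as ordered pairs, so that each of them occurs twice.\<close>

locale closing_position =
  fixes V :: "'a set" and N Y :: "'a \<Rightarrow> 'a set" and C :: "('a \<times> 'a) set" and q :: nat
  assumes finite_V: "finite V"
    and N_sub: "v \<in> V \<Longrightarrow> N v \<subseteq> V"
    and N_irrefl: "v \<notin> N v"
    and N_sym: "u \<in> N v \<Longrightarrow> v \<in> N u"
    and Y_sub: "Y v \<subseteq> N v"
    and Y_card: "card (Y v) \<le> q div 2"
    and Y_full: "v \<in> V \<Longrightarrow> card (N v) \<le> q div 2 \<Longrightarrow> Y v = N v"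
    and C_sub: "C \<subseteq> V \<times> V"
    and C_sym: "(x, y) \<in> C \<Longrightarrow> (y, x) \<in> C"
    and C_irrefl: "(x, x) \<notin> C"
    and C_nonadjacent: "(x, y) \<in> C \<Longrightarrow> y \<notin> N x"
    and C_reason: "(x, y) \<in> C \<Longrightarrow> card (N x) \<le> q div 2 \<Longrightarrow> N x \<inter> N y \<noteq> {} \<or>
      q div 2 < card (N y) \<and> q - 2 \<le> card (N y) + card {z \<in> N x. x \<in> Y z}"
    and degree_le: "v \<in> V \<Longrightarrow> card (N v) \<le> q - 2"
    and q_ge: "5 \<le> q"
    and card_V: "2 * card V \<le> (q - 1)\<^sup>2"
begin

section \<open>Quantities attached to a closing position\<close>

definition d :: "'a \<Rightarrow> real" where "d v = card (N v)"
text \<open>With \<open>q = 2 * a + 2\<close>, Maker degrees are at most \<open>2 * a\<close>, a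
  pair of Breaker costs \<open>2 * a\<close>, and equal sharing charges each end
  \<open>a\<close>.\<close>

definition a :: real where "a = (real q - 2) / 2"
definition H :: "'a set" where "H = {v \<in> V. q div 2 < card (N v)}"
definition L :: "'a set" where "L = {v \<in> V. card (N v) \<le> q div 2}"
definition k :: real where "k = card H"
definition l :: real where "l = card L"
text \<open>In this scale a heavy \<open>h\<close> leaves \<open>2 * a - d h = a - t h\<close> to
  the light end of a pair.\<close>

definition t :: "'a \<Rightarrow> real" where "t h = d h - a"
definition Z :: "'a \<Rightarrow> 'a set" where "Z x = {z \<in> N x. x \<in> Y z}"
definition w :: "'a \<Rightarrow> real" where "w x = card (Z x)"
definition CL :: "'a \<Rightarrow> 'a set" where "CL x = {y \<in> L. (x, y) \<in> C}"
definition CH :: "'a \<Rightarrow> 'a set" where "CH x = {h \<in> H. (x, h) \<in> C}"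
text \<open>The heavy vertices that Breaker separates from the light vertex \<open>x\<close> because of their degree; the
  other elements of \<open>CH x\<close> and all of \<open>CL x\<close> share a neighbour with \<open>x\<close>.\<close>

definition E :: "'a \<Rightarrow> 'a set" where "E x = {h \<in> CH x. 2 * a \<le> d h + w x}"
text \<open>The balance of a light vertex, including the payments \<open>d h\<close> that the heavy vertices save on
  pairs not owned by Breaker.\<close>

definition P :: "'a \<Rightarrow> real" where
  "P x = q * a * d x - a * card (CL x) - (\<Sum>h\<in>CH x. 2 * a - d h) + (\<Sum>h\<in>H - CH x. d h)"

lemma q_eq: "real q = 2 * a + 2"
  by (simp add: a_def field_simps)

lemma a_ge: "3/2 \<le> a"
  using q_ge by (simp add: a_def)

lemma V_eq: "V = H \<union> L" and HL_disjoint: "H \<inter> L = {}"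
  by (auto simp: H_def L_def)

lemma finite_HL [simp]: "finite H" "finite L"
  using finite_V by (auto simp: H_def L_def)

lemma finite_N: "v \<in> V \<Longrightarrow> finite (N v)"
  using N_sub finite_V finite_subset by blast

lemma finite_CH [simp]: "finite (CH x)" and finite_CL [simp]: "finite (CL x)"
  and finite_E [simp]: "finite (E x)"
  by (auto simp: CH_def CL_def E_def)

lemma sum_V: "(\<Sum>v\<in>V. f v) = (\<Sum>h\<in>H. f h) + (\<Sum>x\<in>L. f x)"
  using sum.union_disjoint[OF finite_HL HL_disjoint, of f] unfolding V_eq[symmetric] .

lemma H_mem: "h \<in> H \<Longrightarrow> h \<in> V" and L_mem: "x \<in> L \<Longrightarrow> x \<in> V"
  by (auto simp: H_def L_def)

lemma t_ge: assumes "h \<in> H" shows "3/2 \<le> t h"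
proof -
  have "q < 2 * card (N h)" using assms by (auto simp: H_def)
  then have "real q + 1 \<le> 2 * d h" unfolding d_def by linarith
  then show ?thesis using q_eq by (simp add: t_def)
qed

lemma t_le: assumes "h \<in> H" shows "t h \<le> a"
proof -
  have "card (N h) + 2 \<le> q" using degree_le[OF H_mem[OF assms]] q_ge by simp
  then have "d h + 2 \<le> q" unfolding d_def by linarith
  then show ?thesis using q_eq by (simp add: t_def)
qed

lemma d_L: assumes "x \<in> L" shows "d x \<le> a + 1"
proof -
  have "2 * card (N x) \<le> q" using assms by (auto simp: L_def)
  then have "2 * d x \<le> q" unfolding d_def by linarith
  then show ?thesis using q_eq by simp
qed

lemma half_q: "real (q div 2) \<le> a + 1"
  using q_eq by linarith

lemma card_V_le: "k + l \<le> 2 * a * (a + 1) + 1/2"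
proof -
  have "card V = card H + card L"
    using card_Un_disjoint[OF finite_HL HL_disjoint] unfolding V_eq[symmetric] .
  then have "real (2 * card V) = 2 * (k + l)" by (simp add: k_def l_def)
  moreover have "real (2 * card V) \<le> (real q - 1)\<^sup>2"
  proof -
    have "real (2 * card V) \<le> real ((q - 1)\<^sup>2)" using card_V by linarith
    then show ?thesis using q_ge by (simp add: of_nat_diff)
  qed
  ultimately show ?thesis unfolding q_eq by (simp add: power2_eq_square algebra_simps)
qed

lemma nonneg [simp]: "0 \<le> k" "0 \<le> l" "0 \<le> w x" "0 \<le> d x"
  by (auto simp: k_def l_def w_def d_def)

lemma Z_sub: "Z x \<subseteq> N x"
  by (auto simp: Z_def)

lemma finite_Z: "x \<in> V \<Longrightarrow> finite (Z x)"
  using finite_N Z_sub finite_subset by blast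

section \<open>Counting pairs and the global balance\<close>

text \<open>All these vertices share a neighbour with \<open>x\<close>: the other alternative of
  \<open>C_reason\<close> would put the vertex into \<open>E x\<close>. A neighbour \<open>y\<close>
  of \<open>x\<close> accounts for at most \<open>d y - 1\<close> of them, as \<open>x\<close> is
  itself adjacent to \<open>y\<close>.\<close>

lemma card_near:
  assumes x: "x \<in> L"
  shows "real (card (CL x)) + real (card (CH x - E x)) \<le> (\<Sum>y\<in>N x. d y - 1)"
proof -
  have xV: "x \<in> V" using x L_mem by blast
  have sub: "CL x \<union> (CH x - E x) \<subseteq> (\<Union>y\<in>N x. N y - {x})"
  proof
    fix z assume z: "z \<in> CL x \<union> (CH x - E x)"
    then have zC: "(x, z) \<in> C" by (auto simp: CL_def CH_def)
    have "\<not> (q div 2 < card (N z) \<and> q - 2 \<le> card (N z) + card {y \<in> N x. x \<in> Y y})"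
    proof
      assume *: "q div 2 < card (N z) \<and> q - 2 \<le> card (N z) + card {y \<in> N x. x \<in> Y y}"
      then have "z \<in> CH x - E x" using z by (auto simp: CL_def L_def)
      moreover have "2 * a \<le> d z + w x"
      proof -
        have "q \<le> 2 + card (N z) + card {y \<in> N x. x \<in> Y y}" using * by linarith
        then have "real q \<le> 2 + d z + w x" unfolding d_def w_def Z_def by linarith
        then show ?thesis using q_eq by linarith
      qed
      ultimately show False by (auto simp: E_def)
    qed
    then have "N x \<inter> N z \<noteq> {}" using C_reason[OF zC] x by (auto simp: L_def)
    then obtain y where "y \<in> N x" "y \<in> N z" by blast
    moreover have "z \<noteq> x" using zC C_irrefl by blast
    ultimately show "z \<in> (\<Union>y\<in>N x. N y - {x})" using N_sym by blast
  qed
  have fin: "finite (\<Union>y\<in>N x. N y - {x})"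
    using finite_N[OF xV] N_sub[OF xV] finite_N by blast
  have "card (CL x) + card (CH x - E x) = card (CL x \<union> (CH x - E x))"
    using HL_disjoint by (intro card_Un_disjoint[symmetric]) (auto simp: CL_def CH_def)
  also have "\<dots> \<le> card (\<Union>y\<in>N x. N y - {x})" by (rule card_mono[OF fin sub])
  also have "\<dots> \<le> (\<Sum>y\<in>N x. card (N y - {x}))" by (rule card_UN_le[OF finite_N[OF xV]])
  finally have "real (card (CL x) + card (CH x - E x)) \<le> (\<Sum>y\<in>N x. real (card (N y - {x})))"
    by (metis of_nat_le_iff of_nat_sum)
  also have "\<dots> = (\<Sum>y\<in>N x. d y - 1)"
  proof (rule sum.cong)
    fix y assume y: "y \<in> N x"
    then have "x \<in> N y" "finite (N y)" using N_sym N_sub[OF xV] finite_N by blast+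
    then have "card (N y - {x}) = card (N y) - 1" "1 \<le> card (N y)"
      by (auto simp: Suc_le_eq card_gt_0_iff)
    then show "real (card (N y - {x})) = d y - 1" by (simp add: d_def of_nat_diff)
  qed simp
  finally show ?thesis by simp
qed

text \<open>Double counting: \<open>z\<close> lies in \<open>Z x\<close> only for
  \<open>x \<in> Y z\<close>, hence for at most \<open>q div 2\<close> vertices
  \<open>x\<close>.\<close>

lemma sum_young_le:
  fixes F :: "'a \<Rightarrow> real"
  assumes F: "\<And>z. z \<in> H \<Longrightarrow> 0 \<le> F z"
  shows "(\<Sum>x\<in>L. \<Sum>z\<in>Z x \<inter> H. F z) \<le> (q div 2) * (\<Sum>z\<in>H. F z)"
proof -
  have "(\<Sum>x\<in>L. \<Sum>z\<in>Z x \<inter> H. F z) = (\<Sum>x\<in>L. \<Sum>z | z \<in> H \<and> z \<in> Z x. F z)"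
    by (intro sum.cong) auto
  also have "\<dots> = (\<Sum>z\<in>H. \<Sum>x | x \<in> L \<and> z \<in> Z x. F z)"
    by (rule sum.swap_restrict) auto
  also have "\<dots> = (\<Sum>z\<in>H. card {x \<in> L. z \<in> Z x} * F z)" by simp
  also have "\<dots> \<le> (\<Sum>z\<in>H. (q div 2) * F z)"
  proof (intro sum_mono mult_right_mono F)
    fix z assume z: "z \<in> H"
    have "finite (Y z)" using Y_sub finite_N[OF H_mem[OF z]] finite_subset by blast
    then have "card {x \<in> L. z \<in> Z x} \<le> card (Y z)"
      by (intro card_mono) (auto simp: Z_def)
    then show "real (card {x \<in> L. z \<in> Z x}) \<le> real (q div 2)"
      using Y_card[of z] by linarith
  qed
  finally show ?thesis by (simp add: sum_distrib_left)
qed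

text \<open>As \<open>C\<close> consists of ordered pairs, \<open>a * card C\<close> is a cost of
  \<open>2 * a\<close> per pair. A heavy \<open>h\<close> is charged \<open>d h\<close> for every
  light vertex; for pairs that Breaker does not own, this amount is credited to the light vertex in
  \<open>P\<close>.\<close>

lemma balance:
  "q * a * (\<Sum>v\<in>V. d v) - a * card C \<ge> (\<Sum>h\<in>H. (k - 1) * t h) + (\<Sum>x\<in>L. P x)"
proof -
  have split: "card {y. (x, y) \<in> C} = card (CH x) + card (CL x)" if "x \<in> V" for x
  proof -
    have "{y. (x, y) \<in> C} = CH x \<union> CL x" using C_sub by (auto simp: CH_def CL_def H_def L_def)
    moreover have "CH x \<inter> CL x = {}" using HL_disjoint by (auto simp: CH_def CL_def)
    ultimately show ?thesis using card_Un_disjoint[OF finite_CH finite_CL] by metis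
  qed
  have "C = Sigma V (\<lambda>x. {y. (x, y) \<in> C})" using C_sub by auto
  then have "card C = card (Sigma V (\<lambda>x. {y. (x, y) \<in> C}))" by simp
  also have "\<dots> = (\<Sum>x\<in>V. card {y. (x, y) \<in> C})"
  proof (rule card_SigmaI[OF finite_V], intro ballI)
    fix x assume "x \<in> V"
    have "{y. (x, y) \<in> C} \<subseteq> V" using C_sub by auto
    then show "finite {y. (x, y) \<in> C}" using finite_V finite_subset by blast
  qed
  also have "\<dots> = (\<Sum>x\<in>H. card (CH x) + card (CL x)) + (\<Sum>x\<in>L. card (CH x) + card (CL x))"
    using split H_mem L_mem by (simp add: sum_V)
  finally have cardC: "real (card C) = (\<Sum>h\<in>H. real (card (CH h)) + card (CL h))
      + (\<Sum>x\<in>L. real (card (CH x)) + card (CL x))"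
    by simp
  have swap: "(\<Sum>x\<in>L. \<Sum>h\<in>CH x. F h) = (\<Sum>h\<in>H. card (CL h) * F h)" for F :: "'a \<Rightarrow> real"
  proof -
    have "(\<Sum>x\<in>L. \<Sum>h\<in>CH x. F h) = (\<Sum>h\<in>H. \<Sum>x | x \<in> L \<and> (x, h) \<in> C. F h)"
      unfolding CH_def by (rule sum.swap_restrict) auto
    also have "\<dots> = (\<Sum>h\<in>H. card (CL h) * F h)"
      using C_sym by (auto intro!: sum.cong arg_cong[where f = card] simp: CL_def)
    finally show ?thesis .
  qed
  have swap': "(\<Sum>x\<in>L. \<Sum>h\<in>H - CH x. F h) = (\<Sum>h\<in>H. (l - card (CL h)) * F h)"
    for F :: "'a \<Rightarrow> real"
  proof -
    have "(\<Sum>x\<in>L. \<Sum>h\<in>H - CH x. F h) = (\<Sum>x\<in>L. (\<Sum>h\<in>H. F h) - (\<Sum>h\<in>CH x. F h))"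
      by (intro sum.cong sum_diff) (auto simp: CH_def)
    then show ?thesis
      by (simp add: sum_subtractf swap l_def left_diff_distrib sum_distrib_left)
  qed
  \<comment> \<open>The terms in \<open>card (CL h)\<close> cancel. There are at most
    \<open>k - 1\<close> heavy partners at cost \<open>a\<close> each, and
    \<open>k + l - 1 \<le> q * a\<close> lets the income cover \<open>d h\<close> for all other
    vertices.\<close>
  have one: "a * (card (CH h) + card (CL h)) + (k - 1) * t h + a * card (CL h)
      - 2 * a * card (CL h) + l * d h \<le> q * a * d h" if h: "h \<in> H" for h
  proof -
    have "CH h \<subseteq> H - {h}" using C_irrefl by (auto simp: CH_def)
    then have "card (CH h) \<le> card (H - {h})" by (intro card_mono) auto
    also have "\<dots> = card H - 1" using h by simp
    finally have "card (CH h) + 1 \<le> card H"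
      using h card_gt_0_iff[of H] by fastforce
    then have "real (card (CH h)) \<le> k - 1" unfolding k_def by linarith
    then have 1: "a * card (CH h) \<le> a * (k - 1)" using a_ge by (intro mult_left_mono) auto
    have "k + l - 1 \<le> q * a" using card_V_le unfolding q_eq by (simp add: algebra_simps)
    then have 2: "(k + l - 1) * d h \<le> q * a * d h" by (intro mult_right_mono) auto
    show ?thesis using 1 2 by (simp add: t_def algebra_simps)
  qed
  have "a * card C + (\<Sum>h\<in>H. (k - 1) * t h) + (\<Sum>x\<in>L. P x)
    = (\<Sum>h\<in>H. a * (card (CH h) + card (CL h)) + (k - 1) * t h)
      + (\<Sum>x\<in>L. a * card (CH x) + q * a * d x - (\<Sum>h\<in>CH x. 2 * a - d h) + (\<Sum>h\<in>H - CH x. d h))"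
    unfolding cardC P_def
    by (simp add: sum.distrib sum_subtractf sum_distrib_left distrib_left mult_ac)
  also have "(\<Sum>x\<in>L. a * card (CH x) + q * a * d x - (\<Sum>h\<in>CH x. 2 * a - d h) + (\<Sum>h\<in>H - CH x. d h))
    = (\<Sum>x\<in>L. \<Sum>h\<in>CH x. a) + (\<Sum>x\<in>L. q * a * d x) - (\<Sum>x\<in>L. \<Sum>h\<in>CH x. 2 * a - d h)
       + (\<Sum>x\<in>L. \<Sum>h\<in>H - CH x. d h)"
    by (simp add: sum.distrib sum_subtractf mult_ac sum_distrib_left)
  also have "(\<Sum>x\<in>L. \<Sum>h\<in>CH x. a) = (\<Sum>h\<in>H. card (CL h) * a)" by (rule swap)
  also have "(\<Sum>x\<in>L. \<Sum>h\<in>CH x. 2 * a - d h) = (\<Sum>h\<in>H. card (CL h) * (2 * a - d h))"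
    by (rule swap)
  also have "(\<Sum>x\<in>L. \<Sum>h\<in>H - CH x. d h) = (\<Sum>h\<in>H. (l - card (CL h)) * d h)" by (rule swap')
  finally have "a * card C + (\<Sum>h\<in>H. (k - 1) * t h) + (\<Sum>x\<in>L. P x)
    = (\<Sum>h\<in>H. a * (card (CH h) + card (CL h)) + (k - 1) * t h + a * card (CL h)
      - 2 * a * card (CL h) + l * d h) + (\<Sum>x\<in>L. q * a * d x)"
    by (simp add: sum.distrib sum_subtractf algebra_simps mult.left_commute sum_distrib_left)
  also have "\<dots> \<le> (\<Sum>h\<in>H. q * a * d h) + (\<Sum>x\<in>L. q * a * d x)"
    by (intro add_right_mono sum_mono one)
  also have "\<dots> = q * a * (\<Sum>v\<in>V. d v)"
    by (simp add: sum_V sum_distrib_left distrib_left)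
  finally show ?thesis by simp
qed


lemma d_le: assumes "y \<in> V" shows "d y \<le> 2 * a"
proof -
  have "card (N y) + 2 \<le> q" using degree_le[OF assms] q_ge by simp
  then have "d y + 2 \<le> q" unfolding d_def by linarith
  then show ?thesis using q_eq by simp
qed

lemma sum_mem_if: "finite A \<Longrightarrow> (\<Sum>z\<in>A. if z \<in> B then F z else (0::real)) = (\<Sum>z\<in>A \<inter> B. F z)"
  by (simp add: sum.inter_restrict)

text \<open>A pair with a common neighbour costs \<open>x\<close> at most \<open>a\<close>. By
  \<open>card_near\<close> the edge to \<open>y\<close> bears at most \<open>a * (d y - 1)\<close>
  of this and keeps \<open>a * (2 * a + 3 - d y)\<close> of its income \<open>q * a\<close>. Only
  the remainders of young edges are retained.\<close>

lemma P_ge: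
  assumes x: "x \<in> L"
  shows "(\<Sum>z\<in>Z x. a * (2 * a + 3 - d z)) - (\<Sum>h\<in>E x. 2 * a - d h) \<le> P x"
proof -
  have xV: "x \<in> V" using x L_mem by blast
  have sub: "E x \<subseteq> CH x" by (auto simp: E_def)
  have "(\<Sum>h\<in>CH x - E x. 2 * a - d h) \<le> (\<Sum>h\<in>CH x - E x. a)"
    using t_ge by (intro sum_mono) (force simp: CH_def t_def)
  then have 1: "(\<Sum>h\<in>CH x. 2 * a - d h) \<le> (\<Sum>h\<in>E x. 2 * a - d h) + a * card (CH x - E x)"
    using sum.subset_diff[OF sub finite_CH, of "\<lambda>h. 2 * a - d h"] by (simp add: mult.commute)
  have 2: "0 \<le> (\<Sum>h\<in>H - CH x. d h)" by (intro sum_nonneg) simp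
  have 3: "a * (real (card (CL x)) + real (card (CH x - E x))) \<le> a * (\<Sum>y\<in>N x. d y - 1)"
    using card_near[OF x] a_ge by (intro mult_left_mono) auto
  have "(\<Sum>z\<in>Z x. a * (2 * a + 3 - d z)) \<le> (\<Sum>z\<in>N x. a * (2 * a + 3 - d z))"
    using Z_sub finite_N[OF xV] N_sub[OF xV] d_le a_ge
    by (intro sum_mono2 mult_nonneg_nonneg) force+
  also have "\<dots> = q * a * d x - a * (\<Sum>y\<in>N x. d y - 1)"
    unfolding q_eq by (simp add: d_def sum_subtractf sum_distrib_left[symmetric] algebra_simps)
  finally show ?thesis using 1 2 3 unfolding P_def by (simp add: distrib_left)
qed

section \<open>Nonnegativity of the balance, for few and for many heavy vertices\<close>

text \<open>A vertex of \<open>E x\<close> costs \<open>x\<close> at most \<open>w x\<close>, so it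
  suffices that each edge in \<open>Z x\<close> pays \<open>card (E x)\<close>. An edge to a light
  \<open>z\<close> keeps at least \<open>a * (a + 2) \<ge> k\<close>. A heavy \<open>z\<close> is
  adjacent to \<open>x\<close>, hence not in \<open>E x\<close>, so at most \<open>k - 1\<close> is
  needed; \<open>z\<close> covers the deficit by \<open>young_excess_le\<close>.\<close>

lemma few_heavy:
  assumes k: "k \<le> a * (a + 2)"
  shows "0 \<le> (\<Sum>h\<in>H. (k - 1) * t h) + (\<Sum>x\<in>L. P x)"
proof -
  let ?F = "\<lambda>z. max 0 ((k - 1) - a * (2 * a + 3 - d z))"
  have P: "- (\<Sum>z\<in>Z x \<inter> H. ?F z) \<le> P x" if x: "x \<in> L" for x
  proof -
    have xV: "x \<in> V" using x L_mem by blast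
    have "(\<Sum>h\<in>E x. 2 * a - d h) \<le> (\<Sum>h\<in>E x. w x)"
      by (intro sum_mono) (auto simp: E_def)
    then have 1: "(\<Sum>h\<in>E x. 2 * a - d h) \<le> (\<Sum>z\<in>Z x. real (card (E x)))"
      by (simp add: w_def mult.commute)
    have "- (if z \<in> H then ?F z else 0) \<le> a * (2 * a + 3 - d z) - card (E x)" if z: "z \<in> Z x" for z
    proof (cases "z \<in> H")
      case True
      have "E x \<subseteq> H - {z}" using C_nonadjacent z by (auto simp: E_def CH_def Z_def)
      then have "card (E x) \<le> card H - 1"
        using card_mono[of "H - {z}" "E x"] True by simp
      then have "real (card (E x)) \<le> k - 1"
        unfolding k_def using True card_gt_0_iff[of H] by fastforce
      then show ?thesis using True by simp
    next
      case False
      then have "z \<in> L" using z Z_sub N_sub[OF xV] V_eq by blast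
      then have "a * (a + 2) \<le> a * (2 * a + 3 - d z)"
        using d_L a_ge by (intro mult_left_mono) force+
      moreover have "real (card (E x)) \<le> k"
        unfolding k_def by (auto intro!: card_mono simp: E_def CH_def)
      ultimately show ?thesis using False k by simp
    qed
    then have "(\<Sum>z\<in>Z x. - (if z \<in> H then ?F z else 0)) \<le> (\<Sum>z\<in>Z x. a * (2 * a + 3 - d z) - card (E x))"
      by (rule sum_mono)
    then show ?thesis using 1 P_ge[OF x] sum_mem_if[OF finite_Z[OF xV], of H ?F]
      by (simp add: sum_negf sum_subtractf)
  qed
  have "(\<Sum>x\<in>L. \<Sum>z\<in>Z x \<inter> H. ?F z) \<le> (q div 2) * (\<Sum>z\<in>H. ?F z)"
    by (rule sum_young_le) simp
  also have "\<dots> = (\<Sum>z\<in>H. (q div 2) * ?F z)" by (simp add: sum_distrib_left)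
  also have "\<dots> \<le> (\<Sum>z\<in>H. (k - 1) * t z)"
  proof (rule sum_mono)
    fix z assume z: "z \<in> H"
    have "1 \<le> k" unfolding k_def using z card_gt_0_iff[of H] by fastforce
    then show "(q div 2) * ?F z \<le> (k - 1) * t z"
      using young_excess_le[of "real (q div 2)" a "d z" "k - 1"] half_q a_ge k t_ge[OF z] t_le[OF z]
      by (simp add: t_def)
  qed
  finally have "(\<Sum>x\<in>L. \<Sum>z\<in>Z x \<inter> H. ?F z) \<le> (\<Sum>z\<in>H. (k - 1) * t z)" .
  moreover have "- (\<Sum>x\<in>L. \<Sum>z\<in>Z x \<inter> H. ?F z) \<le> (\<Sum>x\<in>L. P x)"
    using sum_mono[of L "\<lambda>x. - (\<Sum>z\<in>Z x \<inter> H. ?F z)" P] P by (simp add: sum_negf)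
  ultimately show ?thesis by linarith
qed

text \<open>With many heavy vertices, each heavy \<open>h\<close> passes \<open>t h\<close> of its surplus on to each light vertex.\<close>

lemma many_heavy_small_w:
  assumes k: "a * (a + 2) \<le> k" and x: "x \<in> L" and w: "w x < a / 2"
  shows "(\<Sum>h\<in>H. a * (t h)\<^sup>2 / k) - (\<Sum>z\<in>Z x \<inter> H. (t z - 1)\<^sup>2) \<le> P x + (\<Sum>h\<in>H. t h)"
proof -
  have xV: "x \<in> V" using x L_mem by blast
  have a2: "a * (a + 2) = a\<^sup>2 + 2 * a" by (simp add: power2_eq_square algebra_simps)
  have k2: "a\<^sup>2 \<le> k" using k a2 a_ge by linarith
  have "0 < a\<^sup>2" using a_ge by simp
  with k2 have k0: "0 < k" by linarith
  \<comment> \<open>The minimum over \<open>t\<close> of \<open>a * (a + 3 - t) + (t - 1)^2\<close>,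
    attained at \<open>t = 1 + a / 2\<close>: what a young edge keeps if a heavy end
    \<open>z\<close> supports it with \<open>(t z - 1)^2\<close>.\<close>
  let ?b = "3/4 * a\<^sup>2 + 2 * a"
  have "?b - (if z \<in> H then (t z - 1)\<^sup>2 else 0) \<le> a * (2 * a + 3 - d z)" if z: "z \<in> Z x" for z
  proof (cases "z \<in> H")
    case True
    have "0 \<le> (t z - 1 - a / 2)\<^sup>2" by simp
    then show ?thesis using True by (simp add: t_def power2_eq_square field_simps)
  next
    case False
    then have "z \<in> L" using z Z_sub N_sub[OF xV] V_eq by blast
    then have "a * (a + 2) \<le> a * (2 * a + 3 - d z)"
      using d_L a_ge by (intro mult_left_mono) force+
    moreover have "?b \<le> a * (a + 2)" using a2 zero_le_power2[of a] by linarith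
    ultimately show ?thesis using False by simp
  qed
  then have "(\<Sum>z\<in>Z x. ?b - (if z \<in> H then (t z - 1)\<^sup>2 else 0)) \<le> (\<Sum>z\<in>Z x. a * (2 * a + 3 - d z))"
    by (rule sum_mono)
  then have 1: "w x * ?b - (\<Sum>z\<in>Z x \<inter> H. (t z - 1)\<^sup>2) \<le> (\<Sum>z\<in>Z x. a * (2 * a + 3 - d z))"
    using sum_mem_if[OF finite_Z[OF xV], of H "\<lambda>z. (t z - 1)\<^sup>2"]
    by (simp add: sum_subtractf w_def)
  \<comment> \<open>The amount \<open>w x * ?b\<close> is spread evenly over the \<open>k\<close>
    heavy vertices; those in \<open>E x\<close> need it when \<open>2 * t h - a\<close> is
    small.\<close>
  have "(\<Sum>h\<in>H. a * (t h)\<^sup>2 / k)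
    \<le> (\<Sum>h\<in>H. t h - (if h \<in> E x then 2 * a - d h else 0) + w x * ?b / k)"
  proof (rule sum_mono)
    fix h assume h: "h \<in> H"
    show "a * (t h)\<^sup>2 / k \<le> t h - (if h \<in> E x then 2 * a - d h else 0) + w x * ?b / k"
    proof (cases "h \<in> E x")
      case True
      then have "a - t h \<le> w x" by (simp add: E_def t_def)
      then have "a * (t h)\<^sup>2 / k \<le> 2 * t h - a + w x * ?b / k"
        using w t_le[OF h] a_ge k by (intro small_degree_ge_square) auto
      then show ?thesis using True by (simp add: t_def)
    next
      case False
      have "a * (t h)\<^sup>2 \<le> a\<^sup>2 * t h"
        using t_ge[OF h] t_le[OF h] a_ge by (simp add: power2_eq_square mult_right_mono mult_left_mono)
      also have "\<dots> \<le> k * t h" using k2 t_ge[OF h] by (intro mult_right_mono) auto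
      finally have "a * (t h)\<^sup>2 / k \<le> t h" using k0 by (simp add: divide_le_eq mult.commute)
      moreover have "0 \<le> w x * ?b / k" using k0 a_ge by simp
      ultimately show ?thesis using False by simp
    qed
  qed
  also have "\<dots> = (\<Sum>h\<in>H. t h) - (\<Sum>h\<in>E x. 2 * a - d h) + w x * ?b"
  proof -
    have "H \<inter> E x = E x" by (auto simp: E_def CH_def)
    moreover have "(\<Sum>h\<in>H. w x * ?b / k) = w x * ?b"
    proof -
      have "(\<Sum>h\<in>H. w x * ?b / k) = k * (w x * ?b / k)" by (simp add: k_def)
      then show ?thesis using k0 by simp
    qed
    ultimately show ?thesis
      using sum_mem_if[OF finite_HL(1), of "E x" "\<lambda>h. 2 * a - d h"]
      by (simp add: sum.distrib sum_subtractf)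
  qed
  finally show ?thesis using 1 P_ge[OF x] by linarith
qed

text \<open>Costs are split into weights \<open>a - 2 * u\<close> and \<open>2 * u\<close>. The
  young edges cover the first part of the charge and leave \<open>a * u^2\<close>, which is what
  \<open>hinge_ge_square\<close> needs to turn the hinges into squares.\<close>

lemma many_heavy_large_w:
  assumes k: "a * (a + 2) \<le> k" and x: "x \<in> L" and w: "a / 2 \<le> w x"
  shows "(\<Sum>h\<in>H. a * (t h)\<^sup>2 / k) - (\<Sum>z\<in>Z x \<inter> H. (t z - 1)\<^sup>2) \<le> P x + (\<Sum>h\<in>H. t h)"
proof -
  have xV: "x \<in> V" using x L_mem by blast
  have a2: "a * (a + 2) = a\<^sup>2 + 2 * a" by (simp add: power2_eq_square algebra_simps)
  have k2: "a\<^sup>2 \<le> k" using k a2 a_ge by linarith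
  have "0 < a\<^sup>2" using a_ge by simp
  with k2 have k0: "0 < k" by linarith
  \<comment> \<open>Membership in \<open>E x\<close> forces \<open>u \<le> t h\<close>, and
    \<open>u \<le> a / 2\<close> makes both weights nonnegative.\<close>
  define u where "u = max 0 (a - w x)"
  have u: "0 \<le> u" "u \<le> a / 2" "a - w x \<le> u" using w a_ge by (auto simp: u_def max_def)
  let ?m = "\<lambda>h. 2 * max 0 (t h - u)"
  have qa: "k + l - 1 \<le> q * a" using card_V_le unfolding q_eq by (simp add: algebra_simps)

  \<comment> \<open>A claimed pair with a common neighbour is charged partly, with weight \<open>a - 2 * u\<close>, as one of the
    at most \<open>k + l - 1\<close> pairs at \<open>x\<close>, and partly, with weight \<open>2 * u\<close>, to its common neighbour.\<close>
  have "CL x \<subseteq> L - {x}" using C_irrefl by (auto simp: CL_def)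
  then have "card (CL x) \<le> card L - 1" using card_mono[of "L - {x}" "CL x"] x by simp
  then have "real (card (CL x)) \<le> l - 1"
    unfolding l_def using x card_gt_0_iff[of L] by fastforce
  then have "(a - 2 * u) * card (CL x) \<le> (a - 2 * u) * (l - 1)"
    using u by (intro mult_left_mono) auto
  then have cl: "a * card (CL x) \<le> (a - 2 * u) * (l - 1) + 2 * u * card (CL x)"
    by (simp add: algebra_simps)

  \<comment> \<open>For \<open>h \<in> E x\<close>, the gift \<open>t h\<close> less the payment
    \<open>a - t h\<close> is exactly \<open>2 * (t h - u) - (a - 2 * u)\<close>.\<close>
  have "(\<Sum>h\<in>H. ?m h - (a - 2 * u) - (if h \<in> CH x - E x then 2 * u else 0))
    \<le> (\<Sum>h\<in>H. t h - (if h \<in> CH x then 2 * a - d h else 0) + (if h \<in> H - CH x then d h else 0))"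
  proof (rule sum_mono)
    fix h assume h: "h \<in> H"
    have "u \<le> t h" if "h \<in> E x"
      using that t_ge[OF h] by (auto simp: u_def E_def t_def)
    then show "?m h - (a - 2 * u) - (if h \<in> CH x - E x then 2 * u else 0)
      \<le> t h - (if h \<in> CH x then 2 * a - d h else 0) + (if h \<in> H - CH x then d h else 0)"
      using h t_ge[OF h] u by (auto simp: t_def max_def)
  qed
  moreover have "H \<inter> CH x = CH x" "H \<inter> (CH x - E x) = CH x - E x" "H \<inter> (H - CH x) = H - CH x"
    by (auto simp: CH_def)
  ultimately have "(\<Sum>h\<in>H. ?m h) - k * (a - 2 * u) - 2 * u * card (CH x - E x)
    \<le> (\<Sum>h\<in>H. t h) - (\<Sum>h\<in>CH x. 2 * a - d h) + (\<Sum>h\<in>H - CH x. d h)"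
    using sum_mem_if[OF finite_HL(1), of "CH x" "\<lambda>h. 2 * a - d h"]
      sum_mem_if[OF finite_HL(1), of "CH x - E x" "\<lambda>h. 2 * u"]
      sum_mem_if[OF finite_HL(1), of "H - CH x" d]
    by (simp add: sum.distrib sum_subtractf k_def mult.commute)
  then have 1: "q * a * d x - (a - 2 * u) * (k + l - 1)
      - 2 * u * (real (card (CL x)) + real (card (CH x - E x))) + (\<Sum>h\<in>H. ?m h)
    \<le> P x + (\<Sum>h\<in>H. t h)"
    using cl unfolding P_def by (simp add: algebra_simps)
  have 2: "(a - 2 * u) * (k + l - 1) \<le> (a - 2 * u) * (q * a)"
    using u qa by (intro mult_left_mono) auto
  have 3: "2 * u * (real (card (CL x)) + real (card (CH x - E x))) \<le> 2 * u * (\<Sum>y\<in>N x. d y - 1)"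
    using card_near[OF x] u by (intro mult_left_mono) auto

  let ?f = "\<lambda>y. q * a - 2 * u * (d y - 1)"
  have f: "0 \<le> ?f y" if y: "y \<in> N x" for y
  proof -
    have "d y \<le> 2 * a" using y N_sub[OF xV] d_le by blast
    then have "2 * u * (d y - 1) \<le> 2 * u * (2 * a)" using u by (intro mult_left_mono) auto
    also have "\<dots> \<le> a * (2 * a)" using u a_ge by (intro mult_right_mono) auto
    also have "\<dots> \<le> q * a" unfolding q_eq using a_ge by (simp add: algebra_simps)
    finally show ?thesis by simp
  qed
  \<comment> \<open>For heavy \<open>z\<close>,
    \<open>2 * u * (t z - 1) \<le> u^2 + (t z - 1)^2\<close> separates the two vertices; the second
    square is charged to \<open>z\<close>.\<close>
  have fz: "(q * a - 2 * u * a - u\<^sup>2) - (if z \<in> H then (t z - 1)\<^sup>2 else 0) \<le> ?f z" if z: "z \<in> Z x" for z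
  proof (cases "z \<in> H")
    case True
    have "0 \<le> (t z - 1 - u)\<^sup>2" by simp
    then show ?thesis using True by (simp add: t_def power2_eq_square algebra_simps)
  next
    case False
    then have "z \<in> L" using z Z_sub N_sub[OF xV] V_eq by blast
    then have "2 * u * (d z - 1) \<le> 2 * u * a" using d_L u by (intro mult_left_mono) force+
    then have "q * a - 2 * u * a - u\<^sup>2 \<le> ?f z" using zero_le_power2[of u] by linarith
    then show ?thesis using False by simp
  qed
  have "w x * (q * a - 2 * u * a - u\<^sup>2) - (\<Sum>z\<in>Z x \<inter> H. (t z - 1)\<^sup>2)
    = (\<Sum>z\<in>Z x. (q * a - 2 * u * a - u\<^sup>2) - (if z \<in> H then (t z - 1)\<^sup>2 else 0))"
    using sum_mem_if[OF finite_Z[OF xV], of H "\<lambda>z. (t z - 1)\<^sup>2"]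
    by (simp add: sum_subtractf w_def)
  also have "\<dots> \<le> (\<Sum>z\<in>Z x. ?f z)" by (rule sum_mono[OF fz])
  also have "\<dots> \<le> (\<Sum>y\<in>N x. ?f y)"
    using Z_sub finite_N[OF xV] f by (intro sum_mono2) auto
  also have "\<dots> = q * a * d x - 2 * u * (\<Sum>y\<in>N x. d y - 1)"
  proof -
    have "(\<Sum>y\<in>N x. ?f y) = (\<Sum>y\<in>N x. real q * a) - (\<Sum>y\<in>N x. 2 * u * (d y - 1))"
      by (rule sum_subtractf)
    then show ?thesis by (simp add: d_def sum_distrib_left mult.commute)
  qed
  finally have 4: "w x * (q * a - 2 * u * a - u\<^sup>2) - (\<Sum>z\<in>Z x \<inter> H. (t z - 1)\<^sup>2)
    \<le> q * a * d x - 2 * u * (\<Sum>y\<in>N x. d y - 1)" .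
  have 5: "a * u\<^sup>2 \<le> w x * (q * a - 2 * u * a - u\<^sup>2) - (a - 2 * u) * (q * a)"
  proof (cases "w x \<le> a")
    case True
    then have wx: "w x = a - u" by (simp add: u_def)
    have "w x * (q * a - 2 * u * a - u\<^sup>2) - (a - 2 * u) * (q * a) - a * u\<^sup>2
      = u * (2 * a + u\<^sup>2)"
      unfolding wx q_eq by (simp add: power2_eq_square algebra_simps)
    moreover have "0 \<le> u * (2 * a + u\<^sup>2)" using u a_ge by simp
    ultimately show ?thesis by linarith
  next
    case False
    then have "u = 0" by (simp add: u_def)
    moreover have "a * (q * a) \<le> w x * (q * a)" using False a_ge by (intro mult_right_mono) auto
    ultimately show ?thesis by simp
  qed
  have "(\<Sum>h\<in>H. a * (t h)\<^sup>2 / k) \<le> (\<Sum>h\<in>H. ?m h + a * u\<^sup>2 / k)"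
    using hinge_ge_square[of a k _ u] k2 k0 a_ge u t_ge t_le by (intro sum_mono) force
  also have "\<dots> = (\<Sum>h\<in>H. ?m h) + k * (a * u\<^sup>2 / k)" by (simp add: sum.distrib k_def)
  also have "\<dots> = (\<Sum>h\<in>H. ?m h) + a * u\<^sup>2" using k0 by simp
  finally show ?thesis using 1 2 3 4 5 by linarith
qed

text \<open>Summed over the light vertices, a heavy \<open>h\<close> has given away
  \<open>l * t h\<close> and supports at most \<open>q div 2\<close> young edges;
  \<open>many_heavy_balance\<close> then applies to each heavy vertex separately.\<close>

lemma many_heavy:
  assumes k: "a * (a + 2) \<le> k"
  shows "0 \<le> (\<Sum>h\<in>H. (k - 1) * t h) + (\<Sum>x\<in>L. P x)"
proof -
  have "(\<Sum>h\<in>H. a * (t h)\<^sup>2 / k) - (\<Sum>h\<in>H. t h) - (\<Sum>z\<in>Z x \<inter> H. (t z - 1)\<^sup>2) \<le> P x"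
    if "x \<in> L" for x
    using many_heavy_small_w[OF k that] many_heavy_large_w[OF k that] by linarith
  then have "(\<Sum>x\<in>L. (\<Sum>h\<in>H. a * (t h)\<^sup>2 / k) - (\<Sum>h\<in>H. t h) - (\<Sum>z\<in>Z x \<inter> H. (t z - 1)\<^sup>2))
    \<le> (\<Sum>x\<in>L. P x)"
    by (rule sum_mono)
  moreover have "(\<Sum>x\<in>L. \<Sum>z\<in>Z x \<inter> H. (t z - 1)\<^sup>2) \<le> (q div 2) * (\<Sum>z\<in>H. (t z - 1)\<^sup>2)"
    by (rule sum_young_le) simp
  ultimately have "l * (\<Sum>h\<in>H. a * (t h)\<^sup>2 / k) - l * (\<Sum>h\<in>H. t h) - (q div 2) * (\<Sum>z\<in>H. (t z - 1)\<^sup>2)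
    \<le> (\<Sum>x\<in>L. P x)"
    by (simp add: sum_subtractf l_def right_diff_distrib)
  moreover have "0 \<le> (\<Sum>h\<in>H. (k - 1 - l) * t h + l * (a * (t h)\<^sup>2 / k) - (q div 2) * (t h - 1)\<^sup>2)"
    using many_heavy_balance[OF a_ge k card_V_le] t_ge t_le half_q by (intro sum_nonneg) auto
  moreover have "(\<Sum>h\<in>H. (k - 1 - l) * t h + l * (a * (t h)\<^sup>2 / k) - (q div 2) * (t h - 1)\<^sup>2)
    = (\<Sum>h\<in>H. (k - 1) * t h) - l * (\<Sum>h\<in>H. t h) + l * (\<Sum>h\<in>H. a * (t h)\<^sup>2 / k)
      - (q div 2) * (\<Sum>z\<in>H. (t z - 1)\<^sup>2)"
    by (simp only: sum.distrib sum_subtractf sum_distrib_left left_diff_distrib)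
  ultimately show ?thesis by linarith
qed

text \<open>The budget condition with both sides doubled: \<open>C\<close> counts each pair twice,
  and the degree sum counts each Maker edge twice.\<close>

theorem card_C_le: "card C \<le> q * (\<Sum>v\<in>V. card (N v))"
proof -
  have "0 \<le> (\<Sum>h\<in>H. (k - 1) * t h) + (\<Sum>x\<in>L. P x)"
    using few_heavy many_heavy by linarith
  then have "a * card C \<le> a * (q * (\<Sum>v\<in>V. d v))" using balance by (simp add: algebra_simps)
  then have "real (card C) \<le> q * (\<Sum>v\<in>V. d v)" using a_ge by simp
  also have "\<dots> = real (q * (\<Sum>v\<in>V. card (N v)))" by (simp add: d_def)
  finally show ?thesis by linarith
qed

end

subsection \<open>Breaker's strategy\<close>

definition neighbours :: "edge set \<Rightarrow> nat \<Rightarrow> nat set" where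
  "neighbours M v = {u. {v, u} \<in> M}"

text \<open>Lists of Maker edges have the most recent edge first. A pair \<open>(z, x)\<close> in \<open>young c es\<close> means that
  \<open>{z, x}\<close> is among the first \<open>c\<close> edges at \<open>z\<close>.\<close>

fun young :: "nat \<Rightarrow> edge list \<Rightarrow> (nat \<times> nat) set" where
  "young c [] = {}"
| "young c (e # es) = young c es \<union> {(z, x). e = {z, x} \<and> card (neighbours (set es) z) < c}"

text \<open>It depends on Maker's edges only, and on their order only through \<open>young\<close>.
  In the degree conditions \<open>x\<close> is the heavy end.\<close>

definition closing :: "nat \<Rightarrow> nat \<Rightarrow> edge list \<Rightarrow> edge set" where
  "closing n q es = {e \<in> edges n - set es. \<exists>x y. e = {x, y} \<and>
     (neighbours (set es) x \<inter> neighbours (set es) y \<noteq> {} \<or>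
      q div 2 < card (neighbours (set es) x) \<and>
        (q div 2 < card (neighbours (set es) y) \<or>
         q - 2 \<le> card (neighbours (set es) x)
           + card {z \<in> neighbours (set es) y. (z, y) \<in> young (q div 2) es}))}"

section \<open>Edges and neighbourhoods\<close>

lemma finite_edges: "finite (edges n)"
  by (rule finite_subset[of _ "Pow {..<n}"]) (auto simp: edges_def)

lemma edge_iff: "{x, y} \<in> edges n \<longleftrightarrow> x < n \<and> y < n \<and> x \<noteq> y"
  by (auto simp: edges_def card_insert_if)

lemma edge_cases: assumes "e \<in> edges n" obtains x y where "e = {x, y}" "x \<noteq> y" "x < n" "y < n"
proof -
  from assms obtain x y where "e = {x, y}" "x \<noteq> y" by (auto simp: edges_def card_2_iff)
  moreover from this assms have "x < n" "y < n" by (simp_all add: edge_iff)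
  ultimately show ?thesis by (rule that)
qed

lemma neighbours_sym: "u \<in> neighbours M v \<longleftrightarrow> v \<in> neighbours M u"
  unfolding neighbours_def mem_Collect_eq by (subst insert_commute) (rule refl)

lemma neighbours_sub:
  assumes "M \<subseteq> edges n"
  shows "neighbours M v \<subseteq> {..<n}"
proof
  fix u assume "u \<in> neighbours M v"
  then have "{v, u} \<in> edges n" using assms by (simp add: neighbours_def subset_iff)
  then show "u \<in> {..<n}" by (simp add: edge_iff)
qed

lemma finite_neighbours: "M \<subseteq> edges n \<Longrightarrow> finite (neighbours M v)"
  by (rule finite_subset[OF neighbours_sub]) auto

lemma neighbours_irrefl:
  assumes "M \<subseteq> edges n"
  shows "v \<notin> neighbours M v"
proof
  assume "v \<in> neighbours M v"
  then have "{v, v} \<in> edges n" using assms unfolding neighbours_def by blast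
  then show False using edge_iff[of v v n] by simp
qed

lemma neighbours_mono: "M \<subseteq> M' \<Longrightarrow> neighbours M v \<subseteq> neighbours M' v"
  by (auto simp: neighbours_def)

lemma neighbours_insert:
  "u \<noteq> v \<Longrightarrow> neighbours (insert {u, v} M) u = insert v (neighbours M u)"
  "z \<notin> {u, v} \<Longrightarrow> neighbours (insert {u, v} M) z = neighbours M z"
  by (auto simp: neighbours_def doubleton_eq_iff)

lemma card_ordered_pairs:
  assumes "S \<subseteq> edges n"
  shows "card {(x, y). {x, y} \<in> S} = 2 * card S"
proof -
  have "finite S" using assms finite_edges finite_subset by blast
  then show ?thesis using assms
  proof (induction S)
    case (insert e S)
    then obtain u v where e: "e = {u, v}" "u \<noteq> v" using edge_cases by blast
    have fin: "finite {(x, y). {x, y} \<in> S}"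
      by (rule finite_subset[of _ "{..<n} \<times> {..<n}"]) (use insert.prems edge_iff in blast)+
    have "{(x, y). {x, y} \<in> insert e S} = insert (u, v) (insert (v, u) {(x, y). {x, y} \<in> S})"
      by (auto simp: e doubleton_eq_iff)
    moreover have "(u, v) \<notin> {(x, y). {x, y} \<in> S}" "(v, u) \<notin> {(x, y). {x, y} \<in> S}"
      using insert.hyps by (auto simp: e insert_commute)
    ultimately show ?case using insert fin e by simp
  qed simp
qed

lemma sum_card_neighbours:
  assumes "M \<subseteq> edges n"
  shows "(\<Sum>v<n. card (neighbours M v)) = 2 * card M"
proof -
  have "{(x, y). {x, y} \<in> M} = Sigma {..<n} (neighbours M)"
    using assms by (auto simp: neighbours_def edge_iff)
  then have "card {(x, y). {x, y} \<in> M} = (\<Sum>v<n. card (neighbours M v))"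
    using finite_neighbours[OF assms] by (simp add: card_SigmaI)
  then show ?thesis using card_ordered_pairs[OF assms] by simp
qed

section \<open>Young edges\<close>

lemma young_sub: "(z, x) \<in> young c es \<Longrightarrow> x \<in> neighbours (set es) z"
  by (induction es) (auto simp: neighbours_def)

text \<open>Young pairs at \<open>z\<close> lead to neighbours of \<open>z\<close>, and a new one
  arises only while there are fewer than \<open>c\<close> neighbours.\<close>

lemma card_young:
  assumes "set es \<subseteq> edges n"
  shows "card {x. (z, x) \<in> young c es} \<le> c"
  using assms
proof (induction es)
  case (Cons e es)
  show ?case
  proof (cases "\<exists>x. e = {z, x} \<and> card (neighbours (set es) z) < c")
    case True
    then obtain x where x: "e = {z, x}" "card (neighbours (set es) z) < c" by blast
    have sub: "{x. (z, x) \<in> young c es} \<subseteq> neighbours (set es) z" using young_sub by blast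
    have fin: "finite (neighbours (set es) z)" using finite_neighbours[of "set es" n] Cons.prems by simp
    have "{y. (z, y) \<in> young c (e # es)} \<subseteq> insert x {y. (z, y) \<in> young c es}"
      using x by (auto simp: doubleton_eq_iff)
    then have "card {y. (z, y) \<in> young c (e # es)} \<le> card (insert x {y. (z, y) \<in> young c es})"
      using finite_subset[OF sub fin] by (intro card_mono) auto
    also have "\<dots> \<le> Suc (card {y. (z, y) \<in> young c es})" by (rule card_insert_le_m1) auto
    also have "\<dots> \<le> Suc (card (neighbours (set es) z))" using card_mono[OF fin sub] by simp
    finally show ?thesis using x by simp
  next
    case False
    then have "{x. (z, x) \<in> young c (e # es)} = {x. (z, x) \<in> young c es}" by auto
    then show ?thesis using Cons by simp
  qed
qed simp

text \<open>While the degree stays at most \<open>c\<close>, every new edge at \<open>z\<close>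
  found fewer than \<open>c\<close> earlier ones.\<close>

lemma young_all:
  assumes "set es \<subseteq> edges n" "card (neighbours (set es) z) \<le> c"
  shows "{x. (z, x) \<in> young c es} = neighbours (set es) z"
  using assms
proof (induction es)
  case (Cons e es)
  have fin: "finite (neighbours (set es) z)" and fin': "finite (neighbours (set (e # es)) z)"
    using finite_neighbours[of _ n] Cons.prems(1) by simp_all
  have mono: "neighbours (set es) z \<subseteq> neighbours (set (e # es)) z" by (intro neighbours_mono) auto
  have "card (neighbours (set es) z) \<le> c"
    using card_mono[OF fin' mono] Cons.prems(2) by linarith
  then have IH: "{x. (z, x) \<in> young c es} = neighbours (set es) z" using Cons by simp
  show ?case
  proof (rule antisym)
    show "{x. (z, x) \<in> young c (e # es)} \<subseteq> neighbours (set (e # es)) z" using young_sub by blast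
    show "neighbours (set (e # es)) z \<subseteq> {x. (z, x) \<in> young c (e # es)}"
    proof
      fix x assume x: "x \<in> neighbours (set (e # es)) z"
      show "x \<in> {x. (z, x) \<in> young c (e # es)}"
      proof (cases "x \<in> neighbours (set es) z")
        case True
        then show ?thesis using IH by auto
      next
        case False
        then have "e = {z, x}" using x by (auto simp: neighbours_def)
        moreover have "card (neighbours (set es) z) < card (neighbours (set (e # es)) z)"
          using False x mono by (intro psubset_card_mono[OF fin']) blast
        ultimately show ?thesis using Cons.prems(2) by simp
      qed
    qed
  qed
qed (simp add: neighbours_def)

section \<open>Growth and size of the closing set\<close>

lemma closing_sub: "closing n q es \<subseteq> edges n - set es"
  by (auto simp: closing_def)

lemma closing_Nil: "closing n q [] = {}"
  by (auto simp: closing_def neighbours_def)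

text \<open>Degrees, common neighbours and young edges only accumulate, so a pair can leave the set
  only by being claimed by Maker. Hence Breaker can own exactly this set at all times.\<close>

lemma closing_mono:
  assumes es: "set (e # es) \<subseteq> edges n" and e: "e \<notin> closing n q es"
  shows "closing n q es \<subseteq> closing n q (e # es)"
proof
  fix p assume p: "p \<in> closing n q es"
  let ?N = "neighbours (set es)" and ?N' = "neighbours (set (e # es))"
  let ?w = "\<lambda>y. card {z \<in> ?N y. (z, y) \<in> young (q div 2) es}"
    and ?w' = "\<lambda>y. card {z \<in> ?N' y. (z, y) \<in> young (q div 2) (e # es)}"
  have sub: "?N v \<subseteq> ?N' v" for v by (intro neighbours_mono) auto
  have fin: "finite (?N' v)" for v by (rule finite_neighbours[OF es])
  have N: "card (?N v) \<le> card (?N' v)" for v by (rule card_mono[OF fin sub])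
  have w: "?w v \<le> ?w' v" for v
    using sub[of v] fin[of v] by (intro card_mono) auto
  from p obtain x y where xy: "p = {x, y}" and *: "?N x \<inter> ?N y \<noteq> {} \<or>
      q div 2 < card (?N x) \<and> (q div 2 < card (?N y) \<or> q - 2 \<le> card (?N x) + ?w y)"
    unfolding closing_def by blast
  have "?N' x \<inter> ?N' y \<noteq> {} \<or>
      q div 2 < card (?N' x) \<and> (q div 2 < card (?N' y) \<or> q - 2 \<le> card (?N' x) + ?w' y)"
  proof -
    have "?N' x \<inter> ?N' y \<noteq> {}" if "?N x \<inter> ?N y \<noteq> {}" using that sub by blast
    with * show ?thesis using N[of x] N[of y] w[of y] by (meson add_le_mono le_trans less_le_trans)
  qed
  moreover have "p \<in> edges n - set (e # es)" using p e by (auto simp: closing_def)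
  ultimately show "p \<in> closing n q (e # es)" using xy unfolding closing_def by blast
qed

lemma closing_I:
  assumes "{x, y} \<in> edges n - set es"
    and "neighbours (set es) x \<inter> neighbours (set es) y \<noteq> {} \<or>
      q div 2 < card (neighbours (set es) x) \<and>
        (q div 2 < card (neighbours (set es) y) \<or>
         q - 2 \<le> card (neighbours (set es) x)
           + card {z \<in> neighbours (set es) y. (z, y) \<in> young (q div 2) es})"
  shows "{x, y} \<in> closing n q es"
  using assms unfolding closing_def by blast

text \<open>Maker's graph and the ordered closing pairs form a \<open>closing_position\<close>;
  halving \<open>card_C_le\<close> gives the bound.\<close>

lemma card_closing:
  assumes es: "set es \<subseteq> edges n" and q: "5 \<le> q" "2 * n \<le> (q - 1)\<^sup>2"
    and deg: "\<And>v. card (neighbours (set es) v) \<le> q - 2"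
  shows "card (closing n q es) \<le> q * card (set es)"
proof -
  let ?C = "{(x, y). {x, y} \<in> closing n q es}"
  let ?Y = "\<lambda>z. {x. (z, x) \<in> young (q div 2) es}"
  have cE: "closing n q es \<subseteq> edges n" using closing_sub by blast
  interpret closing_position "{..<n}" "neighbours (set es)" ?Y ?C q
  proof
    show "?C \<subseteq> {..<n} \<times> {..<n}" using cE edge_iff by blast
    show "(x, x) \<notin> ?C" for x using cE edge_iff by blast
    show "(y, x) \<in> ?C" if "(x, y) \<in> ?C" for x y using that by (simp add: insert_commute)
    show "y \<notin> neighbours (set es) x" if "(x, y) \<in> ?C" for x y
      using that closing_sub by (auto simp: neighbours_def)
    show "neighbours (set es) x \<inter> neighbours (set es) y \<noteq> {} \<or>
        q div 2 < card (neighbours (set es) y) \<and>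
        q - 2 \<le> card (neighbours (set es) y) + card {z \<in> neighbours (set es) x. x \<in> ?Y z}"
      if xy: "(x, y) \<in> ?C" and x: "card (neighbours (set es) x) \<le> q div 2" for x y
    proof -
      from xy obtain x' y' where "{x, y} = {x', y'}" and "neighbours (set es) x' \<inter> neighbours (set es) y' \<noteq> {} \<or>
         q div 2 < card (neighbours (set es) x') \<and>
         (q div 2 < card (neighbours (set es) y') \<or>
         q - 2 \<le> card (neighbours (set es) x')
           + card {z \<in> neighbours (set es) y'. (z, y') \<in> young (q div 2) es})"
        unfolding closing_def by blast
      then show ?thesis using x by (auto simp: doubleton_eq_iff Int_commute)
    qed
    show "neighbours (set es) v \<subseteq> {..<n}" for v by (rule neighbours_sub[OF es])
    show "v \<notin> neighbours (set es) v" for v by (rule neighbours_irrefl[OF es])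
    show "v \<in> neighbours (set es) u" if "u \<in> neighbours (set es) v" for u v
      using that by (simp add: neighbours_sym)
    show "?Y v \<subseteq> neighbours (set es) v" for v using young_sub by blast
    show "card (?Y v) \<le> q div 2" for v by (rule card_young[OF es])
    show "?Y v = neighbours (set es) v" if "card (neighbours (set es) v) \<le> q div 2" for v
      by (rule young_all[OF es that])
  qed (use q deg in simp_all)
  have "2 * card (closing n q es) \<le> q * (\<Sum>v<n. card (neighbours (set es) v))"
    using card_C_le card_ordered_pairs[OF cE] by simp
  then show ?thesis using sum_card_neighbours[OF es] by simp
qed

text \<open>For \<open>q = 4\<close> a light vertex may reach degree \<open>3 > q - 2\<close>, so the discharging argument does not apply.\<close>

lemma card_closing_small:
  assumes es: "set (e # es) \<subseteq> edges n" and e: "e \<notin> set es" and n: "n \<le> 4"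
  shows "card (closing n 4 (e # es)) \<le> 4 * card (set (e # es))"
\<comment> \<open>A single edge closes nothing; from two edges on the budget is at least 8, while
  the board has at most 6 edges.\<close>
proof (cases "es = []")
  case True
  obtain u v where uv: "e = {u, v}" "u \<noteq> v" using es by (auto elim: edge_cases)
  have "card (neighbours {e} z) \<le> 1" for z
  proof -
    have "neighbours {e} z \<subseteq> {if z = u then v else u}"
      using uv by (auto simp: neighbours_def doubleton_eq_iff)
    then show ?thesis using card_mono[of "{if z = u then v else u}"] by simp
  qed
  then have "\<not> 4 div 2 < card (neighbours {e} z)" for z
    using le_less_trans[of "card (neighbours {e} z)" 1 2] by (simp add: not_less)
  moreover have "neighbours {e} x \<inter> neighbours {e} y = {}" if "{x, y} \<in> edges n" for x y
    using that uv by (auto simp: neighbours_def doubleton_eq_iff edge_iff)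
  ultimately have "closing n 4 (e # es) = {}" unfolding True by (auto simp: closing_def)
  then show ?thesis by simp
next
  case False
  then obtain f where "f \<in> set es" by (cases es) auto
  then have "e \<noteq> f" using e by blast
  moreover have "card {e, f} \<le> card (set (e # es))"
    using \<open>f \<in> set es\<close> by (intro card_mono) auto
  ultimately have 2: "2 \<le> card (set (e # es))" by simp
  have "edges n = {s. s \<subseteq> {..<n} \<and> card s = 2}" by (auto simp: edges_def)
  then have "card (edges n) = n choose 2" using n_subsets[of "{..<n}" 2] by simp
  also have "\<dots> \<le> 6"
  proof -
    have "n \<in> {0, 1, 2, 3, 4}" using n by auto
    then show ?thesis by (auto simp: numeral_eq_Suc)
  qed
  finally have "card (closing n 4 (e # es)) \<le> 6"
    using card_mono[OF finite_edges, of "closing n 4 (e # es)" n] closing_sub[of n 4 "e # es"]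
    by (meson Diff_subset le_trans subset_trans)
  then show ?thesis using 2 by linarith
qed

section \<open>Threats, triangles and degrees after a move of Maker\<close>

text \<open>Unclaimed pairs have no common neighbour before the move, so every threat uses the new
  edge \<open>{u, v}\<close>: it joins \<open>u\<close> to a neighbour of \<open>v\<close>, or
  \<open>v\<close> to a neighbour of \<open>u\<close>.\<close>

lemma card_threats_closing:
  assumes es: "set es \<subseteq> edges n" and e: "e \<in> unclaimed n (set es) (closing n q es)"
  shows "card (threats n (insert e (set es)) (closing n q es)) \<le> q"
proof -
  define M where "M = set es"
  define B where "B = closing n q es"
  define N where "N = neighbours M"
  define y where "y = young (q div 2) es"
  have N_iff: "b \<in> N a \<longleftrightarrow> {a, b} \<in> M" for a b by (simp add: N_def neighbours_def)
  have fin: "finite (N a)" for a unfolding N_def M_def by (rule finite_neighbours[OF es])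
  have eE: "e \<in> edges n" "e \<notin> M" "e \<notin> B"
    using e by (auto simp: unclaimed_def M_def B_def)
  have B_I: "{a, b} \<in> B" if "{a, b} \<in> edges n" "{a, b} \<notin> M"
    "N a \<inter> N b \<noteq> {} \<or> q div 2 < card (N a) \<and>
      (q div 2 < card (N b) \<or> q - 2 \<le> card (N a) + card {z \<in> N b. (z, b) \<in> y})" for a b
    using that closing_I[of a b n es q] unfolding B_def M_def N_def y_def by simp
  \<comment> \<open>Pairs with two heavy ends belong to Breaker, so one end of \<open>e\<close> is
    light and is called \<open>v\<close>.\<close>
  obtain u v where uv: "e = {u, v}" "u \<noteq> v" "card (N v) \<le> q div 2"
  proof -
    obtain a b where ab: "e = {a, b}" "a \<noteq> b" using eE edge_cases by blast
    then have "card (N a) \<le> q div 2 \<or> card (N b) \<le> q div 2"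
      using B_I[of a b] eE by (metis not_le)
    then show thesis using that[of a b] that[of b a] ab by (auto simp: insert_commute)
  qed
  define A where "A = {z \<in> N v. {u, z} \<in> unclaimed n M B}"
  have "threats n (insert e M) B \<subseteq> (\<lambda>z. {u, z}) ` A \<union> (\<lambda>z. {v, z}) ` N u"
  proof
    fix p assume "p \<in> threats n (insert e M) B"
    then obtain a b c where p: "p = {a, b}" "p \<in> unclaimed n (insert e M) B"
      and acb: "{a, c} \<in> insert e M" "{c, b} \<in> insert e M"
      unfolding threats_def by blast
    have pE: "{a, b} \<in> edges n" "{a, b} \<notin> M" "{a, b} \<notin> B"
      using p by (auto simp: unclaimed_def)
    then have "a \<noteq> b" by (metis edge_iff)
    have one: "{x, z} \<in> (\<lambda>z. {u, z}) ` A \<union> (\<lambda>z. {v, z}) ` N u"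
      if "{x, z} = {a, b}" "{x, c} = e" "{c, z} \<in> M" for x z
    proof -
      from that(2) uv consider "x = u" "c = v" | "x = v" "c = u" by (auto simp: doubleton_eq_iff)
      then show ?thesis
      proof cases
        case 1
        then have "z \<in> A" using that pE by (auto simp: A_def N_iff unclaimed_def)
        then show ?thesis using 1 by blast
      next
        case 2
        then show ?thesis using that by (auto simp: N_iff)
      qed
    qed
    show "p \<in> (\<lambda>z. {u, z}) ` A \<union> (\<lambda>z. {v, z}) ` N u"
    proof (cases "{a, c} = e")
      case True
      then have "{c, b} \<noteq> e" using \<open>a \<noteq> b\<close> by (auto simp: doubleton_eq_iff)
      then show ?thesis using one[of a b] True acb p by simp
    next
      case False
      then have ac: "{a, c} \<in> M" using acb by simp
      have "{c, b} \<notin> M"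
      proof
        assume "{c, b} \<in> M"
        then have "c \<in> N a \<inter> N b" using ac by (simp add: N_iff insert_commute)
        then show False using B_I[of a b] pE by blast
      qed
      then have "{b, c} = e" using acb by (auto simp: insert_commute)
      then show ?thesis using one[of b a] ac p by (simp add: insert_commute)
    qed
  qed
  moreover have finA: "finite A" using fin by (simp add: A_def)
  ultimately have "card (threats n (insert e M) B) \<le> card ((\<lambda>z. {u, z}) ` A \<union> (\<lambda>z. {v, z}) ` N u)"
    using fin by (intro card_mono) auto
  also have "\<dots> \<le> card ((\<lambda>z. {u, z}) ` A) + card ((\<lambda>z. {v, z}) ` N u)" by (rule card_Un_le)
  also have "\<dots> \<le> card A + card (N u)" by (intro add_mono card_image_le finA fin)
  also have "\<dots> \<le> q"
  proof (cases "card (N u) \<le> q div 2")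
    case True
    have "card A \<le> card (N v)" using fin by (intro card_mono) (auto simp: A_def)
    then show ?thesis using True uv by linarith
  next
    case False
    \<comment> \<open>With \<open>u\<close> heavy, an unclaimed \<open>{u, z}\<close> forces
      \<open>z\<close> to be light, and then all edges at \<open>z\<close> are young there.\<close>
    have "A \<subseteq> {z \<in> N v. (z, v) \<in> y}"
    proof
      fix z assume z: "z \<in> A"
      have "card (N z) \<le> q div 2"
      proof (rule ccontr)
        assume "\<not> card (N z) \<le> q div 2"
        then show False using False z B_I[of u z] by (auto simp: A_def unclaimed_def)
      qed
      then have "{x. (z, x) \<in> y} = N z"
        using young_all[OF es, of z "q div 2"] unfolding y_def N_def M_def by blast
      then show "z \<in> {z \<in> N v. (z, v) \<in> y}"
        using z neighbours_sym[of z M v] unfolding A_def N_def by blast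
    qed
    then have "card A \<le> card {z \<in> N v. (z, v) \<in> y}" using fin by (intro card_mono) auto
    then show ?thesis using False B_I[of u v] eE uv by fastforce
  qed
  finally show ?thesis by (simp add: M_def B_def)
qed

text \<open>A new edge completing a triangle would join two vertices with a common neighbour, so it
  would lie in \<open>closing\<close>.\<close>

lemma no_triangle_insert:
  assumes "\<not> has_triangle (set es)" and e: "e \<in> unclaimed n (set es) (closing n q es)"
  shows "\<not> has_triangle (insert e (set es))"
proof
  assume "has_triangle (insert e (set es))"
  then obtain u v w where uvw: "u \<noteq> v" "v \<noteq> w" "u \<noteq> w"
    and mem: "{u, v} \<in> insert e (set es)" "{v, w} \<in> insert e (set es)" "{u, w} \<in> insert e (set es)"
    unfolding has_triangle_def by blast
  have no: "\<not> ({a, c} \<in> set es \<and> {b, c} \<in> set es)" if "e = {a, b}" for a b c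
  proof
    assume "{a, c} \<in> set es \<and> {b, c} \<in> set es"
    then have "c \<in> neighbours (set es) a \<inter> neighbours (set es) b" by (simp add: neighbours_def)
    then show False using closing_I[of a b n es q] e that by (auto simp: unclaimed_def)
  qed
  have neq: "{u, v} \<noteq> {v, w}" "{u, v} \<noteq> {u, w}" "{v, w} \<noteq> {u, w}"
    using uvw by (auto simp: doubleton_eq_iff)
  show False
  proof (cases "{u, v} = e \<or> {v, w} = e \<or> {u, w} = e")
    case True
    then show ?thesis using no[of u v w] no[of v w u] no[of u w v] mem neq
      by (metis insert_commute insert_iff)
  next
    case False
    then show ?thesis using mem uvw assms(1) unfolding has_triangle_def by blast
  qed
qed

text \<open>At a heavy vertex of degree \<open>q - 2\<close> every remaining pair is closing,
  whatever its other end. A light vertex has degree at most \<open>q div 2\<close>, which is below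
  \<open>q - 2\<close> because \<open>5 \<le> q\<close>.\<close>

lemma degree_insert:
  assumes es: "set es \<subseteq> edges n" and e: "e \<in> unclaimed n (set es) (closing n q es)" and q: "5 \<le> q"
    and deg: "\<And>v. card (neighbours (set es) v) \<le> q - 2"
  shows "card (neighbours (insert e (set es)) v) \<le> q - 2"
proof (cases "v \<in> e")
  case True
  have eE: "e \<in> edges n - set es" "e \<notin> closing n q es" using e by (auto simp: unclaimed_def)
  then obtain x where x: "e = {v, x}" "v \<noteq> x"
    using True edge_cases[of e n] by (metis DiffD1 insert_commute insert_iff singletonD)
  have "card (neighbours (set es) v) < q - 2"
  proof (cases "card (neighbours (set es) v) \<le> q div 2")
    case True
    then show ?thesis using q by linarith
  next
    case False
    then show ?thesis using closing_I[of v x n es q] eE x by fastforce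
  qed
  then show ?thesis using neighbours_insert(1)[OF x(2), of "set es"] x finite_neighbours[OF es, of v]
    by (simp add: card_insert_if)
next
  case False
  have "e \<in> edges n" using e by (simp add: unclaimed_def)
  then obtain a b where "e = {a, b}" using edge_cases by blast
  then show ?thesis using neighbours_insert(2)[of v a b "set es"] False deg by simp
qed

section \<open>The closing strategy wins\<close>

text \<open>Histories list the earliest round first and \<open>closing\<close> expects the latest
  edge first, hence \<open>rev\<close>.\<close>

definition closing_strategy :: "nat \<Rightarrow> nat \<Rightarrow> strategy" where
  "closing_strategy n q h e = closing n q (e # rev (map fst h)) - breaker_edges h"

lemma maker_edges_eq: "maker_edges h = set (rev (map fst h))"
  by (simp add: maker_edges_def)

lemma closing_play:
  assumes "is_play n (closing_strategy n q) h"
  shows "set (rev (map fst h)) \<subseteq> edges n \<and> breaker_edges h = closing n q (rev (map fst h)) \<and>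
    \<not> has_triangle (set (rev (map fst h))) \<and>
    (5 \<le> q \<longrightarrow> (\<forall>v. card (neighbours (set (rev (map fst h))) v) \<le> q - 2))"
  using assms
proof induction
  case start
  then show ?case by (simp add: breaker_edges_def closing_Nil has_triangle_def neighbours_def)
next
  case (round h e)
  define es where "es = rev (map fst h)"
  have IH: "set es \<subseteq> edges n" "breaker_edges h = closing n q es" "\<not> has_triangle (set es)"
    "5 \<le> q \<Longrightarrow> card (neighbours (set es) v) \<le> q - 2" for v
    using round.IH by (simp_all add: es_def)
  have e: "e \<in> unclaimed n (set es) (closing n q es)"
    using round.hyps(2) IH(2) unfolding maker_edges_eq es_def by simp
  then have eE: "e \<in> edges n" "e \<notin> closing n q es" by (auto simp: unclaimed_def)
  have rev: "rev (map fst (h @ [(e, closing_strategy n q h e)])) = e # es" by (simp add: es_def)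
  have "breaker_edges (h @ [(e, closing_strategy n q h e)]) = breaker_edges h \<union> closing n q (e # es)"
    by (auto simp: breaker_edges_def closing_strategy_def es_def)
  also have "\<dots> = closing n q (e # es)"
    using closing_mono[of e es n q] IH eE by auto
  finally show ?case unfolding rev
    using IH eE no_triangle_insert[OF IH(3) e] degree_insert[OF IH(1) e] by auto
qed

theorem breaker_wins_upper:
  assumes q: "4 \<le> q" and n: "2 * n \<le> (q - 1)\<^sup>2"
  shows "breaker_wins n q"
  unfolding breaker_wins_def winning_strategy_def legal_strategy_def
proof (intro exI conjI allI impI)
  fix h e
  assume h: "is_play n (closing_strategy n q) h"
    and e: "e \<in> unclaimed n (maker_edges h) (breaker_edges h)"
  define es where "es = rev (map fst h)"
  have M: "maker_edges h = set es" unfolding es_def by (rule maker_edges_eq)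
  have inv: "set es \<subseteq> edges n" "breaker_edges h = closing n q es"
    "5 \<le> q \<Longrightarrow> card (neighbours (set es) v) \<le> q - 2" for v
    using closing_play[OF h] by (simp_all add: es_def)
  have e': "e \<in> unclaimed n (set es) (closing n q es)" using e M inv by simp
  then have eE: "set (e # es) \<subseteq> edges n" "e \<notin> set es" "e \<notin> closing n q es"
    using inv(1) by (auto simp: unclaimed_def)
  have S: "closing_strategy n q h e = closing n q (e # es) - closing n q es"
    by (simp add: closing_strategy_def inv es_def)
  have "card ((closing n q (e # es) - closing n q es) \<inter> threats n (insert e (set es)) (closing n q es))
    \<le> card (threats n (insert e (set es)) (closing n q es))"
    by (intro card_mono finite_subset[OF _ finite_edges[of n]])
      (auto simp: threats_def unclaimed_def)
  also have "\<dots> \<le> q" by (rule card_threats_closing[OF inv(1) e'])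
  finally have 1: "card ((closing n q (e # es) - closing n q es)
      \<inter> threats n (insert e (set es)) (closing n q es)) \<le> q" .
  have 2: "card (closing n q (e # es)) \<le> q * card (set (e # es))"
  proof (cases "5 \<le> q")
    case True
    have "card (neighbours (set (e # es)) v) \<le> q - 2" for v
      using degree_insert[OF inv(1) e' True inv(3)[OF True], of v] by simp
    then show ?thesis by (rule card_closing[OF eE(1) True n])
  next
    case False
    \<comment> \<open>Here \<open>2 * n \<le> 9\<close>, so \<open>n \<le> 4\<close>.\<close>
    then have "q = 4" using q by simp
    then show ?thesis using card_closing_small[OF eE(1,2)] n by simp
  qed
  show "legal_reply n q (insert e (maker_edges h)) (breaker_edges h) (closing_strategy n q h e)"
    unfolding legal_reply_def M inv(2) S
    using 1 2 closing_sub[of n q "e # es"] closing_mono[OF eE(1,3)]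
    by (auto simp: unclaimed_def Un_absorb1)
next
  fix h assume "is_play n (closing_strategy n q) h"
  then show "\<not> has_triangle (maker_edges h)"
    using closing_play unfolding maker_edges_eq by blast
qed

subsection \<open>Maker's strategy\<close>

lemma breaker_edges_legal:
  assumes "legal_strategy n q \<sigma>" "is_play n \<sigma> h"
  shows "breaker_edges h \<subseteq> edges n \<and> card (breaker_edges h) \<le> q * card (maker_edges h)"
  using assms(2)
proof induction
  case start
  then show ?case by (simp add: breaker_edges_def)
next
  case (round h e)
  have "legal_reply n q (insert e (maker_edges h)) (breaker_edges h) (\<sigma> h e)"
    using assms(1) round.hyps unfolding legal_strategy_def by blast
  moreover have "breaker_edges (h @ [(e, \<sigma> h e)]) = breaker_edges h \<union> \<sigma> h e"
    "maker_edges (h @ [(e, \<sigma> h e)]) = insert e (maker_edges h)"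
    by (auto simp: breaker_edges_def maker_edges_def)
  ultimately show ?case using round.IH by (auto simp: legal_reply_def unclaimed_def)
qed

text \<open>An unclaimed pair of leaves would give Maker a triangle with the centre \<open>0\<close>
  on her next move.\<close>

lemma star_pairs_blocked:
  assumes win: "winning_strategy n q \<sigma>" and h: "is_play n \<sigma> h" and A: "A \<subseteq> {1..<n}"
    and M: "maker_edges h = (\<lambda>v. {0, v}) ` A"
  shows "{p. p \<subseteq> A \<and> card p = 2} \<subseteq> breaker_edges h"
proof
  fix p assume "p \<in> {p. p \<subseteq> A \<and> card p = 2}"
  then obtain u v where p: "p = {u, v}" "u \<noteq> v" "u \<in> A" "v \<in> A" by (auto simp: card_2_iff)
  then have nz: "u \<noteq> 0" "v \<noteq> 0" "u < n" "v < n" using A by auto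
  show "p \<in> breaker_edges h"
  proof (rule ccontr)
    assume "p \<notin> breaker_edges h"
    moreover have "p \<notin> maker_edges h" using nz by (auto simp: M p doubleton_eq_iff)
    ultimately have "p \<in> unclaimed n (maker_edges h) (breaker_edges h)"
      using nz p(2) by (auto simp: unclaimed_def edges_def p(1))
    then have "is_play n \<sigma> (h @ [(p, \<sigma> h p)])" by (rule is_play.round[OF h])
    moreover have "maker_edges (h @ [(p, \<sigma> h p)]) = insert p (maker_edges h)"
      by (auto simp: maker_edges_def)
    moreover have "has_triangle (insert p (maker_edges h))"
      unfolding has_triangle_def M using p nz
      by (intro exI[of _ u] exI[of _ 0] exI[of _ v]) (auto simp: insert_commute)
    ultimately show False using win unfolding winning_strategy_def by metis
  qed
qed

text \<open>If every further edge at the centre were blocked, Breaker would own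
  \<open>d choose 2\<close> pairs of leaves and \<open>n - 1 - d\<close> edges at the centre, within
  a budget of \<open>q * d\<close>.\<close>

lemma maker_star:
  assumes win: "winning_strategy n q \<sigma>" and n: "(real q + 3/2)\<^sup>2 < 2 * real n - 2"
    and "d \<le> 2 * q + 2"
  shows "\<exists>h A. is_play n \<sigma> h \<and> A \<subseteq> {1..<n} \<and> card A = d \<and> maker_edges h = (\<lambda>v. {0, v}) ` A"
  using assms(3)
proof (induction d)
  case 0
  show ?case by (intro exI[of _ "[]"] exI[of _ "{}"]) (simp add: is_play.start maker_edges_def)
next
  case (Suc d)
  then obtain h A where h: "is_play n \<sigma> h" and A: "A \<subseteq> {1..<n}" "card A = d"
    and M: "maker_edges h = (\<lambda>v. {0, v}) ` A"
    by auto
  have finA: "finite A" using A finite_subset by blast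
  have inj: "inj_on (\<lambda>v. {0::nat, v}) X" for X by (auto simp: inj_on_def doubleton_eq_iff)
  have n0: "2 \<le> n"
  proof -
    have "0 \<le> (real q + 3/2)\<^sup>2" by simp
    then show ?thesis using n by linarith
  qed
  let ?P = "{p. p \<subseteq> A \<and> card p = 2}" and ?Q = "(\<lambda>v. {0, v}) ` ({1..<n} - A)"
  have "\<exists>v \<in> {1..<n} - A. {0, v} \<notin> breaker_edges h"
  proof (rule ccontr)
    assume "\<not> ?thesis"
    then have "?P \<union> ?Q \<subseteq> breaker_edges h" using star_pairs_blocked[OF win h A(1) M] by blast
    moreover have B: "breaker_edges h \<subseteq> edges n" "card (breaker_edges h) \<le> q * card (maker_edges h)"
      using breaker_edges_legal[OF _ h] win by (auto simp: winning_strategy_def)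
    moreover have "card (maker_edges h) = d" using M A inj by (simp add: card_image)
    ultimately have "card (?P \<union> ?Q) \<le> q * d"
      using card_mono[of "breaker_edges h" "?P \<union> ?Q"] finite_subset[OF B(1) finite_edges] by simp
    moreover have "card (?P \<union> ?Q) = card ?P + card ?Q"
      using A finA by (intro card_Un_disjoint) auto
    moreover have "card ?P = d choose 2" using n_subsets[OF finA, of 2] A by simp
    moreover have "card ?Q = n - 1 - d" using A finA inj by (simp add: card_image card_Diff_subset)
    ultimately have "(d choose 2) + n \<le> q * d + d + 1" by linarith
    then have "real ((d choose 2) + n) \<le> real (q * d + d + 1)" by (rule of_nat_mono)
    moreover have "real (d choose 2) = real d * (real d - 1) / 2"
      by (cases d) (auto simp: choose_two field_simps real_of_nat_div)
    ultimately have "2 * real n - 2 \<le> real d * (2 * real q + 3 - real d)"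
      by (simp add: field_simps)
    \<comment> \<open>The quadratic in \<open>d\<close> has its maximum at
      \<open>d = q + 3/2\<close>.\<close>
    also have "\<dots> \<le> (real q + 3/2)\<^sup>2"
    proof -
      have "0 \<le> (real d - (real q + 3/2))\<^sup>2" by simp
      then show ?thesis by (simp add: power2_eq_square algebra_simps)
    qed
    finally show False using n by simp
  qed
  then obtain v where v: "v \<in> {1..<n} - A" "{0, v} \<notin> breaker_edges h" by blast
  then have "{0, v} \<in> unclaimed n (maker_edges h) (breaker_edges h)"
    using n0 by (auto simp: unclaimed_def M edge_iff doubleton_eq_iff)
  then have "is_play n \<sigma> (h @ [({0, v}, \<sigma> h {0, v})])" by (rule is_play.round[OF h])
  moreover have "maker_edges (h @ [({0, v}, \<sigma> h {0, v})]) = (\<lambda>v. {0, v}) ` insert v A"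
    using M by (auto simp: maker_edges_def)
  moreover have "insert v A \<subseteq> {1..<n}" "card (insert v A) = Suc d" using v A finA by auto
  ultimately show ?case by blast
qed

theorem breaker_wins_lower:
  assumes "breaker_wins n q"
  shows "2 * real n - 2 \<le> (real q + 3/2)\<^sup>2"
proof (rule ccontr)
  assume "\<not> ?thesis"
  then have n: "(real q + 3/2)\<^sup>2 < 2 * real n - 2" by simp
  obtain \<sigma> where win: "winning_strategy n q \<sigma>" using assms breaker_wins_def by blast
  \<comment> \<open>With \<open>2 * q + 1\<close> leaves the pairs of leaves exactly match the
    budget; \<open>2 * q + 2\<close> is the first larger number of leaves.\<close>
  obtain h A where h: "is_play n \<sigma> h" and A: "A \<subseteq> {1..<n}" "card A = 2 * q + 2"
    and M: "maker_edges h = (\<lambda>v. {0, v}) ` A"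
    using maker_star[OF win n order.refl] by blast
  have finA: "finite A" using A finite_subset by blast
  have B: "breaker_edges h \<subseteq> edges n" "card (breaker_edges h) \<le> q * card (maker_edges h)"
    using breaker_edges_legal[OF _ h] win by (auto simp: winning_strategy_def)
  have "card (maker_edges h) \<le> 2 * q + 2" using M A card_image_le[OF finA] by metis
  then have "q * card (maker_edges h) \<le> q * (2 * q + 2)" by (rule mult_le_mono2)
  moreover have "(2 * q + 2) choose 2 \<le> card (breaker_edges h)"
    using card_mono[OF finite_subset[OF B(1) finite_edges] star_pairs_blocked[OF win h A(1) M]]
      n_subsets[OF finA, of 2] A by simp
  moreover have "(2 * q + 2) choose 2 = (q + 1) * (2 * q + 1)"
  proof -
    have "(2 * q + 2) * (2 * q + 2 - 1) = 2 * ((q + 1) * (2 * q + 1))" by (simp add: algebra_simps)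
    then show ?thesis by (simp add: choose_two)
  qed
  ultimately show False using B by (simp add: algebra_simps)
qed

subsection \<open>The threshold bias\<close>

lemma threshold_bias_ge:
  "sqrt (2 * real n - 2) - 3/2 \<le> real (threshold_bias n)"
proof -
  have "breaker_wins n (threshold_bias n)"
    unfolding threshold_bias_def using breaker_wins_exists by (rule LeastI_ex)
  then have "2 * real n - 2 \<le> (real (threshold_bias n) + 3/2)\<^sup>2" by (rule breaker_wins_lower)
  then have "sqrt (2 * real n - 2) \<le> real (threshold_bias n) + 3/2" by (intro real_le_lsqrt) auto
  then show ?thesis by simp
qed

lemma threshold_bias_le:
  assumes "3 \<le> n"
  shows "int (threshold_bias n) \<le> \<lceil>sqrt (2 * real n)\<rceil> + 1"
proof -
  define m where "m = nat \<lceil>sqrt (2 * real n)\<rceil>"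
  \<comment> \<open>This gives \<open>m \<ge> 3\<close>, so the bias \<open>m + 1\<close> reaches
    the minimum 4 required by \<open>breaker_wins_upper\<close>.\<close>
  have "2 < sqrt (2 * real n)" using assms by (intro real_less_rsqrt) simp
  then have c: "2 < \<lceil>sqrt (2 * real n)\<rceil>" by linarith
  then have m: "int m = \<lceil>sqrt (2 * real n)\<rceil>" by (simp add: m_def)
  with c have m3: "3 \<le> m" by linarith
  have "sqrt (2 * real n) \<le> real m" using m by linarith
  then have "2 * real n \<le> (real m)\<^sup>2" using real_sqrt_le_iff sqrt_le_D by blast
  then have "real (2 * n) \<le> real (m\<^sup>2)" by simp
  then have "2 * n \<le> (m + 1 - 1)\<^sup>2" by (simp only: of_nat_le_iff add_diff_cancel_right')
  then have "breaker_wins n (m + 1)" using m3 by (intro breaker_wins_upper) auto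
  then have "threshold_bias n \<le> m + 1" unfolding threshold_bias_def by (rule Least_le)
  then show ?thesis using m by linarith
qed

theorem theorem1p5:
  "(\<forall>n::nat. n \<ge> 3 \<longrightarrow>
      int (threshold_bias n) \<in>
        {\<lceil>sqrt (2 * real n - 2) - 3 / 2\<rceil> .. \<lceil>sqrt (2 * real n)\<rceil> + 1}) \<and>
   (\<exists>\<epsilon>::nat \<Rightarrow> real. \<epsilon> \<in> o(\<lambda>_. 1) \<and>
      (\<forall>n\<ge>3. real (threshold_bias n) = (sqrt 2 + \<epsilon> n) * sqrt (real n)))"
proof (intro conjI allI impI)
  fix n :: nat assume n: "n \<ge> 3"
  have "\<lceil>sqrt (2 * real n - 2) - 3 / 2\<rceil> \<le> int (threshold_bias n)"
    using threshold_bias_ge[of n] by (simp add: ceiling_le_iff)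
  then show "int (threshold_bias n) \<in>
      {\<lceil>sqrt (2 * real n - 2) - 3 / 2\<rceil> .. \<lceil>sqrt (2 * real n)\<rceil> + 1}"
    using threshold_bias_le[OF n] by simp
next
  define \<epsilon> where "\<epsilon> n = real (threshold_bias n) / sqrt (real n) - sqrt 2" for n
  \<comment> \<open>The constant 3 absorbs the \<open>3/2\<close>, the rounding, and the loss of at
    most 1 in passing from \<open>sqrt (2 * n - 2)\<close> to \<open>sqrt (2 * n)\<close>.\<close>
  have bound: "\<bar>\<epsilon> n\<bar> \<le> 3 / sqrt (real n)" if n: "n \<ge> 3" for n
  proof -
    let ?r = "sqrt (2 * real n)"
    have "(?r - 1)\<^sup>2 \<le> 2 * real n - 2"
    proof -
      have "(3/2)\<^sup>2 \<le> 2 * real n" using n by (simp add: power2_eq_square)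
      then have "3/2 \<le> ?r" by (rule real_le_rsqrt)
      then show ?thesis by (simp add: power2_diff)
    qed
    then have "?r - 1 \<le> sqrt (2 * real n - 2)" by (rule real_le_rsqrt)
    then have "?r - 3 \<le> real (threshold_bias n)" using threshold_bias_ge[of n] by linarith
    moreover have "real (threshold_bias n) \<le> ?r + 3" using threshold_bias_le[OF n] by linarith
    ultimately have "\<bar>real (threshold_bias n) - sqrt 2 * sqrt (real n)\<bar> \<le> 3"
      by (simp add: real_sqrt_mult abs_le_iff)
    moreover have "\<epsilon> n = (real (threshold_bias n) - sqrt 2 * sqrt (real n)) / sqrt (real n)"
      using n by (simp add: \<epsilon>_def field_simps)
    ultimately show ?thesis by (simp add: abs_divide divide_right_mono)
  qed
  have "(\<lambda>n. 3 / sqrt (real n)) \<longlonglongrightarrow> 0"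
    by (intro tendsto_divide_0[OF tendsto_const] filterlim_at_top_imp_at_infinity
        filterlim_compose[OF sqrt_at_top filterlim_real_sequentially])
  moreover have "\<forall>\<^sub>F n in sequentially. norm (\<epsilon> n) \<le> norm (3 / sqrt (real n)) * 1"
    using bound by (intro eventually_sequentiallyI[of 3]) simp
  ultimately have "\<epsilon> \<longlonglongrightarrow> 0" by (rule tendsto_0_le)
  then have "\<epsilon> \<in> o(\<lambda>_. 1)" by (intro smalloI_tendsto) auto
  moreover have "real (threshold_bias n) = (sqrt 2 + \<epsilon> n) * sqrt (real n)" if "n \<ge> 3" for n
    using that by (simp add: \<epsilon>_def field_simps)
  ultimately show "\<exists>\<epsilon>::nat \<Rightarrow> real. \<epsilon> \<in> o(\<lambda>_. 1) \<and>
      (\<forall>n\<ge>3. real (threshold_bias n) = (sqrt 2 + \<epsilon> n) * sqrt (real n))"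
    by blast
qed

end
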